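(* Let $E$ be a separable Banach space over $K$ with dual $E^*$, and let $X$ be an $E$-valued random variable. Then $X$ is $K$-Gaussian if and only if $T(X)$ is $K$-Gaussian for every $T\in E^*$.
   Context: $K$ is a local field (locally compact, non-discrete, totally disconnected topological field) with its non-archimedean absolute value $|\cdot|$ ($|x|=0\iff x=0$, $|xy|=|x||y|$, $|x+y|\le|x|\vee|y|$). A normed space over $K$ is a $K$-vector space $E$ with a map $\|\cdot\|:E\to[0,\infty)$ such that $\|x\|=0\iff x=0$, $\|\alpha x\|=|\alpha|\|x\|$, $\|x+y\|\le\|x\|\vee\|y\|$; it is a Banach space if complete. $E^*$ denotes the space of continuous $K$-linear functionals $E\to K$. A subset $F$ of a normed space is orthogonal if $\|\sum_{i=1}^n\alpha_ix_i\|=\bigvee_{i=1}^n|\alpha_i|\|x_i\|$ for all finite $\{x_1,\dots,x_n\}\subset F$ and $\alpha_i\in K$; orthonormal if moreover all its elements have norm $1$. $K^2$ is normed by $|(x_1,x_2)|=|x_1|\vee|x_2|$. For a separable Banach space $E$ over $K$, an $E$-valued random variable $X$ is $K$-Gaussian if whenever $X_1,X_2$ are two independent copies of $X$ and $(\alpha_{11},\alpha_{12}),(\alpha_{21},\alpha_{22})\in K^2$ are orthonormal, $(\alpha_{11}X_1+\alpha_{12}X_2,\alpha_{21}X_1+\alpha_{22}X_2)$ has the same law as $(X_1,X_2)$. (In particular $K$ itself is such a space.) *)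

theory Defs
  imports "HOL-Probability.Probability"
begin

text \<open>Non-archimedean absolute value on a field, and the local field condition
(topology induced by the absolute value is locally compact and non-discrete;
total disconnectedness is automatic for an ultrametric).\<close>

definition nonarch_absv :: "('k::field \<Rightarrow> real) \<Rightarrow> bool" where
  "nonarch_absv av \<longleftrightarrow>
     (\<forall>x. av x \<ge> 0) \<and> (\<forall>x. av x = 0 \<longleftrightarrow> x = 0) \<and>
     (\<forall>x y. av (x * y) = av x * av y) \<and>
     (\<forall>x y. av (x + y) \<le> max (av x) (av y))"

definition local_field :: "('k::field \<Rightarrow> real) \<Rightarrow> bool" where
  "local_field av \<longleftrightarrow> nonarch_absv av \<and>
     locally_compact_space (Metric_space.mtopology UNIV (\<lambda>x y. av (x - y))) \<and>
     (\<exists>x. 0 < av x \<and> av x < 1)"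

definition normed_space_K ::
  "('k::field \<Rightarrow> real) \<Rightarrow> ('k \<Rightarrow> 'e::ab_group_add \<Rightarrow> 'e) \<Rightarrow> ('e \<Rightarrow> real) \<Rightarrow> bool" where
  "normed_space_K av sc nm \<longleftrightarrow> vector_space sc \<and>
     (\<forall>x. nm x \<ge> 0) \<and> (\<forall>x. nm x = 0 \<longleftrightarrow> x = 0) \<and>
     (\<forall>a x. nm (sc a x) = av a * nm x) \<and>
     (\<forall>x y. nm (x + y) \<le> max (nm x) (nm y))"

definition norm_top :: "('e::ab_group_add \<Rightarrow> real) \<Rightarrow> 'e topology" where
  "norm_top nm = Metric_space.mtopology UNIV (\<lambda>x y. nm (x - y))"

definition separable_banach_K ::
  "('k::field \<Rightarrow> real) \<Rightarrow> ('k \<Rightarrow> 'e::ab_group_add \<Rightarrow> 'e) \<Rightarrow> ('e \<Rightarrow> real) \<Rightarrow> bool" where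
  "separable_banach_K av sc nm \<longleftrightarrow> normed_space_K av sc nm \<and>
     Metric_space.mcomplete UNIV (\<lambda>x y. nm (x - y)) \<and>
     separable_space (norm_top nm)"

definition dual_space_K ::
  "('k::field \<Rightarrow> real) \<Rightarrow> ('k \<Rightarrow> 'e::ab_group_add \<Rightarrow> 'e) \<Rightarrow> ('e \<Rightarrow> real) \<Rightarrow> ('e \<Rightarrow> 'k) set" where
  "dual_space_K av sc nm = {T. Vector_Spaces.linear sc (*) T \<and>
       continuous_map (norm_top nm) (Metric_space.mtopology UNIV (\<lambda>x y. av (x - y))) T}"

definition borel_norm :: "('e::ab_group_add \<Rightarrow> real) \<Rightarrow> 'e measure" where
  "borel_norm nm = sigma UNIV {U. openin (norm_top nm) U}"

definition orthonormal_K2 :: "('k::field \<Rightarrow> real) \<Rightarrow> 'k \<times> 'k \<Rightarrow> 'k \<times> 'k \<Rightarrow> bool" where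
  "orthonormal_K2 av u v \<longleftrightarrow>
     (let n2 = (\<lambda>(x1, x2). max (av x1) (av x2)) in
       n2 u = 1 \<and> n2 v = 1 \<and>
       (\<forall>b1 b2. n2 (b1 * fst u + b2 * fst v, b1 * snd u + b2 * snd v)
                 = max (av b1 * n2 u) (av b2 * n2 v)))"

text \<open>K-Gaussian random variable. Two independent copies X1, X2 of X have joint law
  \<mu> \<Otimes> \<mu> where \<mu> is the law of X; the condition says that the law of
  (a11 X1 + a12 X2, a21 X1 + a22 X2) equals the law of (X1, X2).\<close>

definition K_gaussian ::
  "('k::field \<Rightarrow> real) \<Rightarrow> ('k \<Rightarrow> 'e::ab_group_add \<Rightarrow> 'e) \<Rightarrow> ('e \<Rightarrow> real)
     \<Rightarrow> 'a measure \<Rightarrow> ('a \<Rightarrow> 'e) \<Rightarrow> bool" where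
  "K_gaussian av sc nm M X \<longleftrightarrow>
     (let \<mu> = distr M (borel_norm nm) X in
       \<forall>a11 a12 a21 a22. orthonormal_K2 av (a11, a12) (a21, a22) \<longrightarrow>
         distr (\<mu> \<Otimes>\<^sub>M \<mu>) (borel_norm nm \<Otimes>\<^sub>M borel_norm nm)
           (\<lambda>(x1, x2). (sc a11 x1 + sc a12 x2, sc a21 x1 + sc a22 x2))
         = \<mu> \<Otimes>\<^sub>M \<mu>)"

end

theory Submission
  imports Defs
begin

text \<open>
  Let \<open>\<mu>\<close> be the law of \<open>X\<close> and suppose that all its images under continuous functionals are
  Gaussian. A law on \<open>E\<close> is determined by its images under continuous functionals: the functionals
  generate the Borel sets by Ingleton's Hahn--Banach theorem, and indicators of balls in \<open>K\<^sup>2\<close> are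
  recovered from indicators of strips by averaging over directions, which is a counting argument
  modulo powers of the maximal ideal and needs no characters. In one dimension, invariance under
  \<open>(x, y) \<mapsto> (x + y, y)\<close> says that a law is invariant under translation by every point of its
  support; hence so is \<open>\<mu>\<close>. The law \<open>\<mu>\<close> is also invariant under multiplication by units, so the
  translations preserving it form a module over the ring of integers that has full measure. By
  Fubini \<open>\<mu> \<otimes> \<mu>\<close> is then invariant under shears, and orthonormal pairs of rows are products of
  shears, unit diagonal matrices and a swap.
\<close>

section \<open>Ultrametric groups\<close>

text \<open>The obstacle is that the hypothesis couples two copies of \<open>X\<close> only through
  one and the same functional. It describes the pairs \<open>(T x, T y)\<close>, whereas a
  continuous functional on pairs has the form \<open>T x + S y\<close> with unrelated
  \<open>T\<close> and \<open>S\<close>. So the law of a transformed pair cannot be compared with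
  \<open>\<mu> \<Otimes>\<^sub>M \<mu>\<close> functional by functional, however strong the
  Cramer-Wold theorem is. Invariance of \<open>\<mu>\<close> under a translation or a scaling
  concerns a single vector and can be tested on each \<open>T\<close> separately. Such one-vector
  invariances are therefore extracted from the image laws, lifted to \<open>E\<close>, and only
  there recombined into statements about pairs.

  The Cramer-Wold theorem rests on a growth argument: for two measures with equal strip masses, the
  difference of the masses of a two-dimensional ball is multiplied by the size of the residue field
  when one radius grows by one step of the value group, yet it stays bounded, so it is 0.\<close>

locale ultranorm =
  fixes nm :: "'e::ab_group_add \<Rightarrow> real"
  assumes nonneg [simp]: "0 \<le> nm x"
    and eq_0 [simp]: "nm x = 0 \<longleftrightarrow> x = 0"
    and minus [simp]: "nm (- x) = nm x"
    and ultra: "nm (x + y) \<le> max (nm x) (nm y)"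
begin

lemma zero [simp]: "nm 0 = 0"
  by simp

lemma ultra_diff: "nm (x - y) \<le> max (nm x) (nm y)"
  using ultra[of x "- y"] by simp

lemma dist_commute: "nm (x - y) = nm (y - x)"
  using minus[of "x - y"] by simp

lemma dist_ultra: "nm (x - z) \<le> max (nm (x - y)) (nm (y - z))"
  using ultra[of "x - y" "y - z"] by simp

text \<open>The isosceles principle: \<open>y = (x + y) - x\<close> gives
  \<open>nm y \<le> max (nm (x + y)) (nm x)\<close>, and the second term is too small to be the
  maximum.\<close>

lemma add_less_absorb: "nm x < nm y \<Longrightarrow> nm (x + y) = nm y"
  using ultra[of x y] ultra_diff[of "x + y" x] by (auto simp: max_def split: if_splits)

text \<open>Balls about 0 are subgroups, so a perturbation of norm at most \<open>r\<close> never
  changes a test at radius \<open>r\<close>.\<close>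

lemma add_le_iff: "nm y \<le> r \<Longrightarrow> nm (x + y) \<le> r \<longleftrightarrow> nm x \<le> r"
  using ultra[of x y] ultra_diff[of "x + y" y] by (auto simp: max_def split: if_splits)

sublocale metric: Metric_space UNIV "\<lambda>x y. nm (x - y)"
proof
  show "nm (x - z) \<le> nm (x - y) + nm (y - z)" for x y z
    using dist_ultra[of x z y] nonneg[of "x - y"] nonneg[of "y - z"] by linarith
qed (auto simp: dist_commute)

lemma openin_norm_top:
  "openin (norm_top nm) U \<longleftrightarrow> (\<forall>x\<in>U. \<exists>r>0. \<forall>y. nm (y - x) < r \<longrightarrow> y \<in> U)"
  by (auto simp: norm_top_def metric.openin_mtopology metric.mball_def subset_eq dist_commute)

lemma topspace_norm_top [simp]: "topspace (norm_top nm) = UNIV"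
  by (simp add: norm_top_def)

lemma space_borel_norm [simp]: "space (borel_norm nm) = UNIV"
  by (simp add: borel_norm_def)

lemma sets_borel_norm: "sets (borel_norm nm) = sigma_sets UNIV {U. openin (norm_top nm) U}"
  by (simp add: borel_norm_def)

lemma open_in_sets: "openin (norm_top nm) U \<Longrightarrow> U \<in> sets (borel_norm nm)"
  by (auto simp: sets_borel_norm)

lemma openin_ball: "openin (norm_top nm) {y. nm (y - x) < r}"
  unfolding openin_norm_top
proof (intro ballI)
  fix y assume y: "y \<in> {y. nm (y - x) < r}"
  have "nm (z - x) < r" if "nm (z - y) < r" for z
    using dist_ultra[of z x y] that y by (auto simp: max_def split: if_splits)
  then show "\<exists>s>0. \<forall>z. nm (z - y) < s \<longrightarrow> z \<in> {y. nm (y - x) < r}"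
    using y le_less_trans[OF nonneg[of "y - x"], of r] by (intro exI[of _ r]) auto
qed

lemma openin_cball: "0 < r \<Longrightarrow> openin (norm_top nm) {y. nm (y - x) \<le> r}"
  unfolding openin_norm_top
proof (intro ballI exI[of _ r] conjI allI impI)
  fix y z assume "y \<in> {y. nm (y - x) \<le> r}" "nm (z - y) < r"
  then show "z \<in> {y. nm (y - x) \<le> r}"
    using dist_ultra[of z x y] by (auto simp: max_def split: if_splits)
qed

lemma ball_in_sets: "{y. nm (y - x) < r} \<in> sets (borel_norm nm)"
  by (rule open_in_sets[OF openin_ball])

lemma continuous_map_norm_top_measurable:
  assumes "ultranorm nm'" "continuous_map (norm_top nm) (norm_top nm') f"
  shows "f \<in> measurable (borel_norm nm) (borel_norm nm')"
proof -
  interpret n': ultranorm nm' by fact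
  show ?thesis
    unfolding borel_norm_def[of nm']
  proof (rule measurable_measure_of)
    fix U assume "U \<in> {U. openin (norm_top nm') U}"
    then have "openin (norm_top nm) {x \<in> topspace (norm_top nm). f x \<in> U}"
      using assms(2) by (auto simp: continuous_map)
    then show "f -` U \<inter> space (borel_norm nm) \<in> sets (borel_norm nm)"
      by (auto intro!: open_in_sets simp: vimage_def)
  qed auto
qed

end

section \<open>Countable bases and supports of measures\<close>

locale separable_ultranorm = ultranorm +
  assumes separable: "separable_space (norm_top nm)"
begin

lemma ex_countable_dense: "\<exists>D. countable D \<and> (\<forall>x. \<forall>r>0. \<exists>d\<in>D. nm (x - d) < r)"
proof -
  obtain D where D: "countable D" "norm_top nm closure_of D = UNIV"
    using separable by (auto simp: separable_space_def)
  have "\<exists>d\<in>D. nm (x - d) < r" if "r > 0" for x r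
  proof -
    have "x \<in> norm_top nm closure_of D" using D by simp
    then have "\<exists>y\<in>D. y \<in> metric.mball x r"
      using that unfolding norm_top_def metric.metric_closure_of by auto
    then show ?thesis by (auto simp: metric.mball_def)
  qed
  then show ?thesis using D(1) by blast
qed

lemma countable_ball_base:
  obtains \<B> where "countable \<B>" "\<And>B. B \<in> \<B> \<Longrightarrow> \<exists>x r. 0 < r \<and> B = {y. nm (y - x) < r}"
    "\<And>x r. 0 < r \<Longrightarrow> \<exists>B\<in>\<B>. x \<in> B \<and> (\<forall>y\<in>B. nm (y - x) < r)"
proof -
  obtain D where D: "countable D" "\<And>x r. r > 0 \<Longrightarrow> \<exists>d\<in>D. nm (x - d) < r"
    using ex_countable_dense by blast
  let ?B = "(\<lambda>(d, n). {y. nm (y - d) < 1 / Suc n}) ` (D \<times> (UNIV::nat set))"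
  have "\<exists>B\<in>?B. x \<in> B \<and> (\<forall>y\<in>B. nm (y - x) < r)" if r: "r > 0" for x r
  proof -
    obtain n where n: "1 / Suc n < r" using nat_approx_posE[OF r] .
    obtain d where d: "d \<in> D" "nm (x - d) < 1 / Suc n" using D(2)[of "1 / Suc n" x] by auto
    have "nm (y - x) < r" if "nm (y - d) < 1 / Suc n" for y
      using dist_ultra[of y x d] dist_commute[of x d] that n d by (auto simp: max_def split: if_splits)
    then show ?thesis using d by (intro bexI[of _ "{y. nm (y - d) < 1 / Suc n}"]) auto
  qed
  moreover have "\<exists>x r. 0 < r \<and> B = {y. nm (y - x) < r}" if B: "B \<in> ?B" for B
  proof -
    obtain d and n :: nat where "B = {y. nm (y - d) < 1 / Suc n}" using B by auto
    then show ?thesis by (intro exI[of _ d] exI[of _ "1 / Suc n"]) auto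
  qed
  moreover have "countable ?B" using D(1) by auto
  ultimately show ?thesis using that by presburger
qed

text \<open>By separability an open set of pairs is a countable union of rectangles of basic balls,
  hence lies in the product sigma-algebra. Measurability of addition depends on this.\<close>

lemma open_prod_in_sets:
  assumes "\<And>x y. (x, y) \<in> W \<Longrightarrow> \<exists>r>0. \<forall>x' y'. nm (x' - x) < r \<longrightarrow> nm (y' - y) < r \<longrightarrow> (x', y') \<in> W"
  shows "W \<in> sets (borel_norm nm \<Otimes>\<^sub>M borel_norm nm)"
proof -
  obtain \<B> where B: "countable \<B>" "\<And>B. B \<in> \<B> \<Longrightarrow> \<exists>x r. 0 < r \<and> B = {y. nm (y - x) < r}"
    "\<And>x r. r > 0 \<Longrightarrow> \<exists>B\<in>\<B>. x \<in> B \<and> (\<forall>y\<in>B. nm (y - x) < r)"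
    using countable_ball_base by metis
  let ?I = "{(B, C) \<in> \<B> \<times> \<B>. B \<times> C \<subseteq> W}"
  have "W = (\<Union>(B, C)\<in>?I. B \<times> C)"
  proof (rule subset_antisym; rule subsetI)
    fix z assume z: "z \<in> W"
    obtain x y where xy: "z = (x, y)" by (cases z)
    obtain r where r: "r > 0" "\<forall>x' y'. nm (x' - x) < r \<longrightarrow> nm (y' - y) < r \<longrightarrow> (x', y') \<in> W"
      using assms z xy by blast
    obtain B where "B \<in> \<B>" "x \<in> B" "\<forall>y\<in>B. nm (y - x) < r" using B(3)[OF r(1), of x] by blast
    moreover obtain C where "C \<in> \<B>" "y \<in> C" "\<forall>z\<in>C. nm (z - y) < r" using B(3)[OF r(1), of y] by blast
    moreover have "B \<times> C \<subseteq> W" using calculation r(2) by auto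
    ultimately show "z \<in> (\<Union>(B, C)\<in>?I. B \<times> C)" unfolding xy by blast
  qed auto
  also have "\<dots> \<in> sets (borel_norm nm \<Otimes>\<^sub>M borel_norm nm)"
  proof (rule sets.countable_UN')
    show "countable ?I" using B(1) by (rule_tac countable_subset[of _ "\<B> \<times> \<B>"]) auto
    show "(\<lambda>(B, C). B \<times> C) ` ?I \<subseteq> sets (borel_norm nm \<Otimes>\<^sub>M borel_norm nm)"
    proof (rule image_subsetI)
      fix i assume i: "i \<in> ?I"
      obtain B C where i: "i = (B, C)" "B \<in> \<B>" "C \<in> \<B>" using i by auto
      then obtain x r y s where "B = {z. nm (z - x) < r}" "C = {z. nm (z - y) < s}" using B(2) by metis
      then show "(\<lambda>(B, C). B \<times> C) i \<in> sets (borel_norm nm \<Otimes>\<^sub>M borel_norm nm)"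
        using ball_in_sets i by auto
    qed
  qed
  finally show ?thesis .
qed

text \<open>A point with a null ball around it lies in a null member of the countable base, and the
  union of these members is null.\<close>

lemma AE_support:
  assumes "sets M = sets (borel_norm nm)"
  shows "AE x in M. \<forall>r>0. emeasure M {y. nm (y - x) < r} \<noteq> 0"
proof -
  obtain \<B> where B: "countable \<B>" "\<And>B. B \<in> \<B> \<Longrightarrow> \<exists>x r. 0 < r \<and> B = {y. nm (y - x) < r}"
    "\<And>x r. r > 0 \<Longrightarrow> \<exists>B\<in>\<B>. x \<in> B \<and> (\<forall>y\<in>B. nm (y - x) < r)"
    using countable_ball_base by metis
  have meas: "B \<in> sets M" if "B \<in> \<B>" for B
    using B(2)[OF that] ball_in_sets assms by metis
  have "\<Union> {B \<in> \<B>. emeasure M B = 0} \<in> null_sets M"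
    using B(1) meas by (subst SUP_id_eq[symmetric]) (intro null_sets_UN', auto)
  then have "AE x in M. x \<notin> \<Union> {B \<in> \<B>. emeasure M B = 0}"
    by (rule AE_not_in)
  then show ?thesis
  proof (rule AE_mp, intro AE_I2 impI allI notI)
    fix x r assume x: "x \<notin> \<Union> {B \<in> \<B>. emeasure M B = 0}" and r: "(0::real) < r"
      and 0: "emeasure M {y. nm (y - x) < r} = 0"
    obtain B where "B \<in> \<B>" "x \<in> B" "\<forall>y\<in>B. nm (y - x) < r" using B(3)[OF r, of x] by blast
    moreover have "emeasure M B = 0"
      using emeasure_mono[of B "{y. nm (y - x) < r}" M] calculation 0 ball_in_sets assms by auto
    ultimately show False using x by auto
  qed
qed

end

section \<open>Local fields\<close>

locale valued_field =
  fixes av :: "'k::field \<Rightarrow> real"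
  assumes nonarch: "nonarch_absv av"
begin

lemma mult [simp]: "av (x * y) = av x * av y"
  and av_eq_0: "av x = 0 \<longleftrightarrow> x = 0"
  and av_nonneg: "0 \<le> av x"
  using nonarch by (auto simp: nonarch_absv_def)

lemma one [simp]: "av 1 = 1"
  using mult[of 1 1] av_eq_0[of 1] by simp

text \<open>Topology and Borel sets of the field are thus instances of what is proved for norms.
  Symmetry under negation comes from \<open>av (- 1) ^ 2 = 1\<close>.\<close>

sublocale ultranorm av
proof
  have "av (- 1) ^ 2 = 1"
    using mult[of "- 1" "- 1"] by (simp add: power2_eq_square)
  then have "av (- 1) = 1"
    using av_nonneg[of "- 1"] by (simp add: power2_eq_1_iff)
  then show "av (- x) = av x" for x
    using mult[of "- 1" x] by simp
qed (use nonarch in \<open>auto simp: nonarch_absv_def\<close>)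

lemma pos [simp]: "0 < av x \<longleftrightarrow> x \<noteq> 0"
  using av_nonneg[of x] av_eq_0[of x] by linarith

lemma inverse [simp]: "av (inverse x) = inverse (av x)"
  using mult[of x "inverse x"] by (cases "x = 0") (auto simp: field_simps)

lemma divide [simp]: "av (x / y) = av x / av y"
  by (simp add: divide_inverse)

lemma power [simp]: "av (x ^ n) = av x ^ n"
  by (induction n) auto

end

locale nonarch_local_field = valued_field +
  assumes local_field: "local_field av"
begin

lemma ex_compact_cball: "\<exists>r>0. compactin (norm_top av) (metric.mcball 0 r)"
proof -
  obtain U C where U: "openin (norm_top av) U" "compactin (norm_top av) C" "0 \<in> U" "U \<subseteq> C"
    using local_field unfolding local_field_def locally_compact_space_def norm_top_def by force
  then obtain r where r: "r > 0" "\<forall>y. av (y - 0) < r \<longrightarrow> y \<in> U"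
    unfolding openin_norm_top by blast
  have "metric.mcball 0 (r / 2) \<subseteq> C"
    using r U by (auto simp: metric.mcball_def subset_eq)
  then have "compactin (norm_top av) (metric.mcball 0 (r / 2))"
    using U(2) metric.closedin_mcball unfolding norm_top_def
    by (meson closed_compactin)
  then show ?thesis using r by (intro exI[of _ "r / 2"]) auto
qed

text \<open>Local compactness provides one compact ball about 0. Division by a high power of some
  \<open>x\<close> with \<open>av x < 1\<close> stretches it beyond any radius, and a translation
  moves the centre.\<close>

lemma compact_cball: "compactin (norm_top av) (metric.mcball a R)"
proof -
  obtain r where r: "r > 0" "compactin (norm_top av) (metric.mcball 0 r)"
    using ex_compact_cball by blast
  obtain x where x: "0 < av x" "av x < 1" using local_field by (auto simp: local_field_def)
  obtain k where "av x ^ k * R < r"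
  proof (cases "R > 0")
    case True
    then obtain k where "av x ^ k < r / R"
      using real_arch_pow_inv[of "r / R" "av x"] x r by auto
    then show ?thesis using that[of k] True by (simp add: field_simps)
  next
    case False
    then show ?thesis using that[of 0] r by simp
  qed
  note k = this
  let ?f = "\<lambda>z. a + z / x ^ k"
  have "continuous_map (norm_top av) (norm_top av) ?f"
    unfolding continuous_map openin_norm_top
  proof (intro conjI allI impI ballI)
    fix U z assume U: "\<forall>x\<in>U. \<exists>r>0. \<forall>y. av (y - x) < r \<longrightarrow> y \<in> U" and z: "z \<in> {z \<in> topspace (norm_top av). ?f z \<in> U}"
    then obtain s where s: "s > 0" "\<forall>y. av (y - ?f z) < s \<longrightarrow> y \<in> U" by blast
    have "?f y \<in> U" if "av (y - z) < s * av x ^ k" for y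
    proof -
      have "av (?f y - ?f z) = av (y - z) / av x ^ k"
        by (simp flip: diff_divide_distrib power divide)
      also have "\<dots> < s" using that x(1) by (simp add: divide_less_eq)
      finally have "av (?f y - ?f z) < s" .
      then show ?thesis using s by blast
    qed
    then show "\<exists>r>0. \<forall>y. av (y - z) < r \<longrightarrow> y \<in> {z \<in> topspace (norm_top av). ?f z \<in> U}"
      using s x by (intro exI[of _ "s * av x ^ k"]) auto
  qed auto
  then have "compactin (norm_top av) (?f ` metric.mcball 0 r)"
    using r(2) image_compactin by blast
  moreover have "metric.mcball a R \<subseteq> ?f ` metric.mcball 0 r"
  proof
    fix y assume "y \<in> metric.mcball a R"
    then have "av (y - a) \<le> R" by (simp add: metric.mcball_def dist_commute)
    then have "av x ^ k * av (y - a) \<le> av x ^ k * R" using x by (simp add: mult_left_mono)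
    then have "x ^ k * (y - a) \<in> metric.mcball 0 r" using k by (simp add: metric.mcball_def)
    moreover have "y = ?f (x ^ k * (y - a))" using x by auto
    ultimately show "y \<in> ?f ` metric.mcball 0 r" by blast
  qed
  ultimately show ?thesis
    using metric.closedin_mcball unfolding norm_top_def by (meson closed_compactin)
qed

lemma ex_finite_net:
  assumes "0 < e"
  shows "\<exists>S. finite S \<and> (\<forall>x. av x \<le> R \<longrightarrow> (\<exists>s\<in>S. av (x - s) < e))"
proof -
  have "metric.mtotally_bounded (metric.mcball 0 R)"
    using compact_cball unfolding norm_top_def by (rule metric.compactin_imp_mtotally_bounded)
  then obtain S where S: "finite S" "metric.mcball 0 R \<subseteq> (\<Union>x\<in>S. metric.mball x e)"
    using assms unfolding metric.mtotally_bounded_def by meson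
  have "\<exists>s\<in>S. av (x - s) < e" if "av x \<le> R" for x
  proof -
    have "x \<in> metric.mcball 0 R" using that by (simp add: metric.mcball_def)
    then have "x \<in> (\<Union>x\<in>S. metric.mball x e)" using S(2) by blast
    then show ?thesis by (auto simp: metric.mball_def dist_commute)
  qed
  then show ?thesis using S(1) by blast
qed

sublocale separable_ultranorm av
proof unfold_locales
  have "\<exists>S. finite S \<and> (\<forall>x. av x \<le> real n \<longrightarrow> (\<exists>s\<in>S. av (x - s) < 1 / Suc m))" for n m
    by (rule ex_finite_net) simp
  then obtain S where S: "\<And>n m. finite (S n m)"
    "\<And>n m x. av x \<le> real n \<Longrightarrow> \<exists>s\<in>S n m. av (x - s) < 1 / Suc m" by metis
  let ?D = "\<Union>n m. S n m"
  have "\<exists>y\<in>?D. y \<in> metric.mball x r" if r: "r > 0" for x r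
  proof -
    obtain m where m: "1 / Suc m < r" using nat_approx_posE[OF r] .
    obtain n where n: "av x \<le> real n" using real_arch_simple by blast
    obtain s where "s \<in> S n m" "av (x - s) < 1 / Suc m" using S(2)[OF n] by blast
    then show ?thesis using m by (intro bexI[of _ s]) (auto simp: metric.mball_def)
  qed
  then have "norm_top av closure_of ?D = UNIV"
    unfolding norm_top_def metric.metric_closure_of by auto
  moreover have "countable ?D" by (intro countable_UN countable_finite[OF S(1)] countableI_type)
  ultimately show "separable_space (norm_top av)"
    unfolding separable_space_def by (intro exI[of _ ?D]) auto
qed

text \<open>The value group is discrete: by the isosceles principle an element with value in
  \<open>[av z, 1)\<close> has the same value as its nearby point in a finite net, so only finitely
  many values occur there and a largest one exists.\<close>

lemma ex_uniformizer: "\<exists>p. 0 < av p \<and> av p < 1 \<and> (\<forall>x. av x < 1 \<longrightarrow> av x \<le> av p)"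
proof -
  obtain z where z: "0 < av z" "av z < 1" using local_field by (auto simp: local_field_def)
  obtain S where S: "finite S" "\<And>x. av x \<le> 1 \<Longrightarrow> \<exists>s\<in>S. av (x - s) < av z"
    using ex_finite_net[OF z(1), of 1] by blast
  let ?A = "{a \<in> av ` S. a < 1 \<and> av z \<le> a}"
  have *: "av x \<in> ?A" if x: "av z \<le> av x" "av x < 1" for x
  proof -
    obtain s where s: "s \<in> S" "av (x - s) < av z" using S(2)[of x] x by auto
    then have "av s = av x"
      using add_less_absorb[of "s - x" x] dist_commute[of x s] x by auto
    then show ?thesis using x s by (metis (mono_tags, lifting) image_eqI mem_Collect_eq)
  qed
  have fin: "finite ?A" using S(1) by auto
  have "Max ?A \<in> ?A" using *[of z] z fin by (intro Max_in) auto
  then obtain p where p: "av p = Max ?A" "av p < 1" "av z \<le> av p" by auto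
  have "av x \<le> av p" if "av x < 1" for x
    using *[of x] Max_ge[OF fin, of "av x"] p that by linarith
  moreover have "0 < av p" using p z by linarith
  ultimately show ?thesis using p by blast
qed

text \<open>Spherical completeness, from compactness. In a finite subfamily the centre of the
  smallest ball belongs to all the others; the finite intersection property inside one compact ball
  does the rest. It supplies the new value in the extension of functionals.\<close>

lemma cballs_Inter_nonempty:
  assumes "\<And>x r y s. (x, r) \<in> F \<Longrightarrow> (y, s) \<in> F \<Longrightarrow> av (x - y) \<le> max r s"
  shows "\<exists>v. \<forall>(x, r)\<in>F. av (v - x) \<le> r"
proof (cases "F = {}")
  case False
  then obtain a R where aR: "(a, R) \<in> F" by auto
  let ?B = "\<lambda>(x, r). metric.mcball x r"
  have fin: "\<exists>v. \<forall>(x, r)\<in>G. v \<in> metric.mcball x r" if "finite G" "G \<subseteq> F" "G \<noteq> {}" for G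
  proof -
    have "Min (snd ` G) \<in> snd ` G" using that by (intro Min_in) auto
    then obtain x0 r0 where 0: "(x0, r0) \<in> G" "Min (snd ` G) = r0" by auto
    then have "r0 \<le> r" if "(x, r) \<in> G" for x r
      using that \<open>finite G\<close> by (metis Min_le finite_imageI image_eqI snd_conv)
    then have "av (x - x0) \<le> r" if "(x, r) \<in> G" for x r
      using assms[of x r x0 r0] that 0(1) \<open>G \<subseteq> F\<close> by (fastforce simp: max_def split: if_splits)
    then show ?thesis by (intro exI[of _ x0]) (auto simp: metric.mcball_def)
  qed
  have "metric.mcball a R \<inter> \<Inter> (?B ` F) \<noteq> {}"
  proof (rule compact_cball[of a R, unfolded compactin_fip, THEN conjunct2, rule_format])
    show "(\<forall>C\<in>?B ` F. closedin (norm_top av) C) \<and>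
      (\<forall>\<F>. finite \<F> \<and> \<F> \<subseteq> ?B ` F \<longrightarrow> metric.mcball a R \<inter> \<Inter> \<F> \<noteq> {})"
    proof (intro conjI ballI allI impI)
      show "closedin (norm_top av) C" if "C \<in> ?B ` F" for C
        using that metric.closedin_mcball unfolding norm_top_def by auto
      fix \<F> assume "finite \<F> \<and> \<F> \<subseteq> ?B ` F"
      then obtain G where G: "G \<subseteq> F" "finite G" "\<F> = ?B ` G"
        by (meson finite_subset_image)
      obtain v where "\<forall>(x, r)\<in>insert (a, R) G. v \<in> metric.mcball x r"
        using fin[of "insert (a, R) G"] G aR by auto
      then show "metric.mcball a R \<inter> \<Inter> \<F> \<noteq> {}" using G by fastforce
    qed
  qed
  then obtain v where "\<forall>(x, r)\<in>F. v \<in> metric.mcball x r" by fastforce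
  then show ?thesis by (intro exI[of _ v]) (auto simp: metric.mcball_def dist_commute)
qed auto

end

section \<open>A Cramer--Wold theorem\<close>

context nonarch_local_field
begin

text \<open>A system of representatives of the ring of integers modulo the ideal of elements of
  value at most \<open>e\<close>. For \<open>e = av p\<close> with \<open>p\<close> a uniformizer it
  represents the residue field.\<close>

definition net :: "real \<Rightarrow> 'a set \<Rightarrow> bool" where
  "net e S \<longleftrightarrow> finite S \<and> (\<forall>s\<in>S. av s \<le> 1) \<and> (\<forall>s\<in>S. \<forall>t\<in>S. av (s - t) \<le> e \<longrightarrow> s = t) \<and>
     (\<forall>x. av x \<le> 1 \<longrightarrow> (\<exists>s\<in>S. av (x - s) \<le> e))"

lemma net_finite: "net e S \<Longrightarrow> finite S"
  and net_le_1: "net e S \<Longrightarrow> s \<in> S \<Longrightarrow> av s \<le> 1"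
  and net_separated: "net e S \<Longrightarrow> s \<in> S \<Longrightarrow> t \<in> S \<Longrightarrow> av (s - t) \<le> e \<Longrightarrow> s = t"
  and net_covers: "net e S \<Longrightarrow> av x \<le> 1 \<Longrightarrow> \<exists>s\<in>S. av (x - s) \<le> e"
  by (auto simp: net_def)

lemma ex_net:
  assumes "0 < e" "e \<le> 1"
  shows "\<exists>S. net e S"
proof -
  obtain F where F: "finite F" "\<And>x. av x \<le> 1 \<Longrightarrow> \<exists>s\<in>F. av (x - s) < e"
    using ex_finite_net[OF assms(1), of 1] by blast
  \<comment> \<open>The predicate under \<open>SOME\<close> depends only on the class of
    \<open>x\<close>, so congruent points receive the same representative.\<close>
  define rep where "rep x = (SOME y. av (y - x) \<le> e)" for x
  have rep: "av (rep x - x) \<le> e" for x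
    unfolding rep_def by (rule someI[of _ x]) (use assms in simp)
  have rep_cong: "rep x = rep y" if "av (x - y) \<le> e" for x y
  proof -
    have "av (z - x) \<le> e \<longleftrightarrow> av (z - y) \<le> e" for z
      using add_le_iff[OF that, of "z - x"] by simp
    then show ?thesis by (simp add: rep_def)
  qed
  let ?S = "rep ` {x. av x \<le> 1}"
  have "?S \<subseteq> rep ` F"
  proof (rule image_subsetI)
    fix x assume "x \<in> {x. av x \<le> 1}"
    then obtain s where "s \<in> F" "av (x - s) < e" using F(2) by blast
    then show "rep x \<in> rep ` F" using rep_cong[of x s] by simp
  qed
  then have "finite ?S" using F(1) finite_surj by blast
  moreover have "av (rep x) \<le> 1" if "av x \<le> 1" for x
    using ultra[of "rep x - x" x] rep[of x] that assms by simp
  moreover have "rep x = rep y" if "av (rep x - rep y) \<le> e" for x y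
  proof -
    have "av (x - y) \<le> e"
      using dist_ultra[of x y "rep x"] dist_ultra[of "rep x" y "rep y"] rep[of x] rep[of y] that
        dist_commute[of x "rep x"] by linarith
    then show ?thesis by (rule rep_cong)
  qed
  moreover have "\<exists>s\<in>?S. av (x - s) \<le> e" if "av x \<le> 1" for x
    using that rep[of x] dist_commute[of x "rep x"] by auto
  ultimately have "net e ?S" by (auto simp: net_def)
  then show ?thesis ..
qed

text \<open>Translation by \<open>b - a\<close> followed by rounding to the net maps one ball into
  the other; it is injective because distinct net points are more than \<open>e\<close> apart. Used
  in both directions, it shows that balls of equal radius hold equally many net points.\<close>

lemma card_net_cball_le:
  assumes S: "net e S" and "av a \<le> 1" "av b \<le> 1" "e \<le> r" "r \<le> 1"
  shows "card {t\<in>S. av (t - a) \<le> r} \<le> card {t\<in>S. av (t - b) \<le> r}"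
proof -
  have "\<exists>s\<in>S. av (t + (b - a) - s) \<le> e" if "t \<in> S" for t
  proof (rule net_covers[OF S])
    show "av (t + (b - a)) \<le> 1"
      using ultra[of t "b - a"] ultra_diff[of b a] net_le_1[OF S that] assms by linarith
  qed
  then obtain g where g: "\<And>t. t \<in> S \<Longrightarrow> g t \<in> S" "\<And>t. t \<in> S \<Longrightarrow> av (t + (b - a) - g t) \<le> e"
    by metis
  have "inj_on g S"
  proof
    fix s t assume st: "s \<in> S" "t \<in> S" "g s = g t"
    have "av (s - t) \<le> e"
      using dist_ultra[of "s + (b - a)" "t + (b - a)" "g s"] g(2)[of s] g(2)[of t] st
        dist_commute[of "g t" "t + (b - a)"] by simp
    then show "s = t" using net_separated[OF S] st by blast
  qed
  moreover have "av (g t - b) \<le> r" if "t \<in> S" "av (t - a) \<le> r" for t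
    using dist_ultra[of "g t" b "t + (b - a)"] g(2)[OF that(1)] that
      dist_commute[of "g t" "t + (b - a)"] assms by (simp add: algebra_simps)
  ultimately show ?thesis
    using g(1) net_finite[OF S] by (intro card_inj_on_le[of g]) (auto intro: inj_on_subset)
qed

text \<open>The ball of radius \<open>av q\<close> splits into \<open>card R\<close> disjoint balls
  of radius \<open>av (p * q)\<close> centred at \<open>a + q * s\<close>. They hold equally many
  net points as long as the net is at least as fine as their radius.\<close>

lemma card_net_cball_scale:
  assumes S: "net e S" and R: "net (av p) R" and "p \<noteq> 0" "av p \<le> 1" "q \<noteq> 0" "av q \<le> 1"
    and e: "e \<le> av (p * q)" and a: "av a \<le> 1"
  shows "card {t\<in>S. av (t - a) \<le> av q} = card R * card {t\<in>S. av (t - a) \<le> av (p * q)}"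
proof -
  let ?B = "\<lambda>s. {t\<in>S. av (t - (a + q * s)) \<le> av (p * q)}"
  have pq: "av (p * q) \<le> av q" using assms by (simp add: mult_left_le_one_le)
  have "{t\<in>S. av (t - a) \<le> av q} = (\<Union>s\<in>R. ?B s)"
  proof (rule subset_antisym; rule subsetI)
    fix t assume t: "t \<in> {t\<in>S. av (t - a) \<le> av q}"
    then have "av ((t - a) / q) \<le> 1" using \<open>q \<noteq> 0\<close> by (subst divide) (simp add: divide_le_eq)
    then obtain s where s: "s \<in> R" "av ((t - a) / q - s) \<le> av p" using net_covers[OF R] by blast
    have "t - (a + q * s) = q * ((t - a) / q - s)" using \<open>q \<noteq> 0\<close> by (simp add: field_simps)
    then have "av (t - (a + q * s)) \<le> av q * av p"
      using s by (simp only: mult) (simp add: mult_left_mono)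
    then show "t \<in> (\<Union>s\<in>R. ?B s)" using s(1) t by (auto simp: mult.commute)
  next
    fix t assume "t \<in> (\<Union>s\<in>R. ?B s)"
    then obtain s where s: "s \<in> R" "t \<in> S" "av (t - (a + q * s)) \<le> av (p * q)" by blast
    have "av (q * s) \<le> av q" using net_le_1[OF R s(1)] by (simp add: mult_left_le)
    moreover have "av (t - a) \<le> max (av (t - (a + q * s))) (av (q * s))"
      using ultra[of "t - (a + q * s)" "q * s"] by (simp add: algebra_simps)
    ultimately show "t \<in> {t\<in>S. av (t - a) \<le> av q}" using s pq by simp
  qed
  moreover have "card (\<Union>s\<in>R. ?B s) = (\<Sum>s\<in>R. card (?B s))"
  proof (rule card_UN_disjoint)
    show "\<forall>i\<in>R. \<forall>j\<in>R. i \<noteq> j \<longrightarrow> ?B i \<inter> ?B j = {}"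
    proof (intro ballI impI equals0I)
      fix i j t assume ij: "i \<in> R" "j \<in> R" "i \<noteq> j" and t: "t \<in> ?B i \<inter> ?B j"
      have "av (q * (i - j)) \<le> max (av (t - (a + q * j))) (av (t - (a + q * i)))"
        using ultra_diff[of "t - (a + q * j)" "t - (a + q * i)"] by (simp add: algebra_simps)
      also have "\<dots> \<le> av p * av q" using t by simp
      finally have "av (i - j) \<le> av p" using \<open>q \<noteq> 0\<close> by (simp add: mult.commute)
      then show False using net_separated[OF R] ij by blast
    qed
  qed (use net_finite[OF S] net_finite[OF R] in auto)
  moreover have "card (?B s) = card {t\<in>S. av (t - a) \<le> av (p * q)}" if "s \<in> R" for s
  proof -
    have "av (q * s) \<le> 1" using net_le_1[OF R that] assms by (simp add: mult_le_one)
    then have "av (a + q * s) \<le> 1" using ultra[of a "q * s"] a by linarith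
    then show ?thesis
      using card_net_cball_le[OF S _ a e] card_net_cball_le[OF S a _ e] pq \<open>av q \<le> 1\<close>
      by (intro antisym) auto
  qed
  ultimately show ?thesis by simp
qed

definition uniformizer :: "'a \<Rightarrow> bool" where
  "uniformizer p \<longleftrightarrow> p \<noteq> 0 \<and> av p < 1 \<and> (\<forall>x. av x < 1 \<longrightarrow> av x \<le> av p)"

text \<open>Averaging over all translates \<open>x + t y\<close> recovers the two-dimensional ball from half-planes.
  The left-hand side vanishes for \<open>1 < av y\<close>, because then the scale of the inequality in \<open>t\<close>
  changes by one step of the value group.\<close>

lemma net_count_identity:
  assumes p: "uniformizer p" and R: "net (av p) R" and S: "net e S" and e: "e * av y \<le> 1"
  shows "real (card R) * card {t\<in>S. av (x + t * y) \<le> 1} - card {t\<in>S. av (p * (x + t * y)) \<le> 1}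
    = real (card S) * (real (card R) * of_bool (av x \<le> 1 \<and> av y \<le> 1) - of_bool (av (p * x) \<le> 1 \<and> av y \<le> 1))"
proof (cases "av y \<le> 1")
  case True
  have p': "av p \<le> 1" using p by (simp add: uniformizer_def)
  \<comment> \<open>Here \<open>t * y\<close> is absorbed by the unit ball, so each test on
    \<open>x + t * y\<close> holds for all \<open>t\<close> in the net or for none.\<close>
  have "av (t * y) \<le> 1" "av (p * (t * y)) \<le> 1" if "t \<in> S" for t
    using net_le_1[OF S that] True p' by (auto intro!: mult_le_one mult_nonneg_nonneg)
  then have "{t\<in>S. av (x + t * y) \<le> 1} = (if av x \<le> 1 then S else {})"
    "{t\<in>S. av (p * (x + t * y)) \<le> 1} = (if av (p * x) \<le> 1 then S else {})"
    using add_le_iff by (auto simp only: distrib_left split: if_splits)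
  then show ?thesis using True by (simp add: algebra_simps)
next
  case False
  then have y: "y \<noteq> 0" by auto
  \<comment> \<open>The two tests cut out balls for \<open>t\<close> about \<open>- x / y\<close>,
    of radii \<open>av (p * q) = 1 / av y\<close> and \<open>av q\<close>. As
    \<open>1 / av y < 1\<close> is a value, it is at most \<open>av p\<close>; hence even the larger
    radius is at most 1.\<close>
  define q where "q = inverse (p * y)"
  have p': "p \<noteq> 0" "av p < 1" using p by (auto simp: uniformizer_def)
  have "av (inverse y) < 1" using False by (simp add: inverse_less_1_iff)
  then have "av (inverse y) \<le> av p" using p by (simp add: uniformizer_def del: inverse)
  then have q: "q \<noteq> 0" "av q \<le> 1" using p' y by (auto simp: q_def field_simps)
  have pq: "av (p * q) = inverse (av y)" using p' y by (simp add: q_def)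
  define a where "a = - x / y"
  have a: "x + t * y = (t - a) * y" for t using y by (simp add: a_def field_simps)
  have 1: "av (x + t * y) \<le> 1 \<longleftrightarrow> av (t - a) \<le> av (p * q)" for t
    unfolding a pq using y by (simp add: inverse_eq_divide le_divide_eq)
  have 2: "av (p * (x + t * y)) \<le> 1 \<longleftrightarrow> av (t - a) \<le> av q" for t
    unfolding a q_def using y p' by (simp add: inverse_eq_divide le_divide_eq mult.left_commute mult.commute)
  have "real (card R) * card {t\<in>S. av (t - a) \<le> av (p * q)} = card {t\<in>S. av (t - a) \<le> av q}"
  proof (cases "av a \<le> 1")
    case True
    have "e \<le> av (p * q)" unfolding pq using e y by (simp add: inverse_eq_divide le_divide_eq)
    then show ?thesis
      using card_net_cball_scale[OF S R] p' q True by simp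
  next
    case False
    \<comment> \<open>The common centre lies outside the unit ball while the net lies inside, so
      both counts are 0.\<close>
    have "\<not> av (t - a) \<le> 1" if "t \<in> S" for t
      using add_le_iff[of t 1 "- a"] net_le_1[OF S that] False by simp
    moreover have "av (p * q) \<le> 1" using q(2) p'(2) by (simp add: mult_le_one)
    ultimately have "{t\<in>S. av (t - a) \<le> av (p * q)} = {}" "{t\<in>S. av (t - a) \<le> av q} = {}"
      using q(2) by fastforce+
    then show ?thesis by (simp only: card.empty)
  qed
  then show ?thesis using False by (simp add: 1 2 del: mult)
qed

text \<open>This is \<open>net_count_identity\<close> integrated over \<open>C\<close>. The identity
  holds at points where the net is fine enough for \<open>g w\<close>, namely
  \<open>av (p ^ k * g w) \<le> 1\<close>; the remaining points produce the error term on the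
  right.\<close>

lemma net_measure_bound:
  fixes M :: "'e measure" and f g :: "'e \<Rightarrow> 'a"
  assumes "finite_measure M" and p: "uniformizer p" and R: "net (av p) R" and S: "net (av p ^ k) S"
    and [measurable]: "C \<in> sets M" "\<And>t. {w. av (f w + t * g w) \<le> 1} \<in> sets M"
      "\<And>t. {w. av (p * (f w + t * g w)) \<le> 1} \<in> sets M"
      "{w. av (p ^ k * g w) \<le> 1} \<in> sets M"
      "{w. av (g w) \<le> 1} \<in> sets M"
      "{w. av (f w) \<le> 1} \<in> sets M" "{w. av (p * f w) \<le> 1} \<in> sets M"
  shows "\<bar>real (card R) * (\<Sum>t\<in>S. measure M (C \<inter> {w. av (f w + t * g w) \<le> 1}))
      - (\<Sum>t\<in>S. measure M (C \<inter> {w. av (p * (f w + t * g w)) \<le> 1}))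
      - real (card S) * (real (card R) * measure M (C \<inter> ({w. av (f w) \<le> 1} \<inter> {w. av (g w) \<le> 1}))
          - measure M (C \<inter> ({w. av (p * f w) \<le> 1} \<inter> {w. av (g w) \<le> 1})))\<bar>
    \<le> (real (card R) + 1) * card S * measure M (space M - {w. av (p ^ k * g w) \<le> 1})"
proof -
  interpret finite_measure M by fact
  note fin = net_finite[OF S]
  define h :: "'e \<Rightarrow> real" where
    "h w = real (card R) * (\<Sum>t\<in>S. indicator (C \<inter> {w. av (f w + t * g w) \<le> 1}) w)
      - (\<Sum>t\<in>S. indicator (C \<inter> {w. av (p * (f w + t * g w)) \<le> 1}) w)
      - real (card S) * (real (card R) * indicator (C \<inter> ({w. av (f w) \<le> 1} \<inter> {w. av (g w) \<le> 1})) w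
          - indicator (C \<inter> ({w. av (p * f w) \<le> 1} \<inter> {w. av (g w) \<le> 1})) w)" for w
  have int: "integrable M (indicator A :: 'e \<Rightarrow> real)" if "A \<in> sets M" for A
    using that by (simp add: integrable_real_indicator less_top[symmetric])
  have bound: "\<bar>h w\<bar> \<le> (real (card R) + 1) * card S * indicator (space M - {w. av (p ^ k * g w) \<le> 1}) w"
    if "w \<in> space M" for w
  proof (cases "w \<in> C")
    case True
    have sum: "(\<Sum>t\<in>S. indicator (C \<inter> {w. P t w}) w :: real) = card {t\<in>S. P t w}" for P
      using True fin by (simp add: indicator_def sum.If_cases Int_def flip: of_bool_def)
    have h: "h w = real (card R) * card {t\<in>S. av (f w + t * g w) \<le> 1}
        - card {t\<in>S. av (p * (f w + t * g w)) \<le> 1}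
        - real (card S) * (real (card R) * of_bool (av (f w) \<le> 1 \<and> av (g w) \<le> 1)
            - of_bool (av (p * f w) \<le> 1 \<and> av (g w) \<le> 1))"
      unfolding h_def sum using True by (simp add: indicator_def)
    show ?thesis
    proof (cases "av (p ^ k * g w) \<le> 1")
      case True
      then have "h w = 0"
        unfolding h by (subst net_count_identity[OF p R S]) simp_all
      then show ?thesis by simp
    next
      case False
      \<comment> \<open>At such points the two-dimensional balls contribute nothing, and each of the
        two counts is at most \<open>card S\<close>.\<close>
      have "\<not> av (g w) \<le> 1"
      proof
        assume "av (g w) \<le> 1"
        moreover have "av p ^ k \<le> 1" using p by (simp add: power_le_one uniformizer_def)
        ultimately have "av p ^ k * av (g w) \<le> 1" by (simp add: mult_le_one)
        then show False using False by simp
      qed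
      then have "h w = real (card R) * card {t\<in>S. av (f w + t * g w) \<le> 1}
        - card {t\<in>S. av (p * (f w + t * g w)) \<le> 1}"
        unfolding h by simp
      moreover have "card {t\<in>S. av (f w + t * g w) \<le> 1} \<le> card S"
        "card {t\<in>S. av (p * (f w + t * g w)) \<le> 1} \<le> card S"
        using fin by (auto intro: card_mono)
      then have "real (card R) * card {t\<in>S. av (f w + t * g w) \<le> 1} \<le> real (card R) * card S"
        "real (card {t\<in>S. av (p * (f w + t * g w)) \<le> 1}) \<le> card S"
        by (auto intro: mult_left_mono)
      moreover have "0 \<le> real (card R) * card {t\<in>S. av (f w + t * g w) \<le> 1}" by simp
      ultimately have "\<bar>h w\<bar> \<le> real (card R) * card S + card S" by linarith
      then show ?thesis using False \<open>w \<in> space M\<close> by (simp add: algebra_simps)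
    qed
  next
    case False
    then show ?thesis by (simp add: h_def)
  qed
  have "\<bar>\<integral>w. h w \<partial>M\<bar> \<le> (\<integral>w. (real (card R) + 1) * card S * indicator (space M - {w. av (p ^ k * g w) \<le> 1}) w \<partial>M)"
  proof (rule order_trans[OF integral_abs_bound integral_mono])
    have "integrable M h"
      unfolding h_def
      by (intro Bochner_Integration.integrable_diff integrable_mult_right Bochner_Integration.integrable_sum int) measurable
    then show "integrable M (\<lambda>w. \<bar>h w\<bar>)" by (rule integrable_abs)
  qed (use bound in \<open>auto intro!: integrable_mult_right int simp del: mult\<close>)
  also have "\<dots> = (real (card R) + 1) * card S * measure M (space M - {w. av (p ^ k * g w) \<le> 1})"
    by (simp add: Int_absorb2)
  also have "(\<integral>w. h w \<partial>M) = real (card R) * (\<Sum>t\<in>S. measure M (C \<inter> {w. av (f w + t * g w) \<le> 1}))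
      - (\<Sum>t\<in>S. measure M (C \<inter> {w. av (p * (f w + t * g w)) \<le> 1}))
      - real (card S) * (real (card R) * measure M (C \<inter> ({w. av (f w) \<le> 1} \<inter> {w. av (g w) \<le> 1}))
          - measure M (C \<inter> ({w. av (p * f w) \<le> 1} \<inter> {w. av (g w) \<le> 1})))"
    unfolding h_def
    by (simp add: int Bochner_Integration.integrable_sum Bochner_Integration.integral_sum sets.Int_space_eq2 sets.sets_into_space Int_absorb2 del: mult)
  finally show ?thesis .
qed

text \<open>Apply \<open>net_measure_bound\<close> to \<open>M\<close> and \<open>N\<close> with the
  same net. The strip sums agree and cancel; division by \<open>card S\<close> and passage to the
  limit in \<open>k\<close> leave \<open>?Q * d f = d (\<lambda>w. p * f w)\<close> for the
  difference \<open>d\<close> of the two masses. Iterated, this makes \<open>?Q ^ n * d f\<close>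
  bounded by the total masses although \<open>?Q \<ge> 2\<close>, so \<open>d f = 0\<close>. The set
  \<open>C\<close> allows strips already treated to be carried along.\<close>

lemma measure_pair_eqI:
  fixes M N :: "'e measure" and V :: "('e \<Rightarrow> 'a) set"
  assumes "finite_measure M" "finite_measure N" and sets: "sets N = sets M"
    and V: "\<And>f g t. f \<in> V \<Longrightarrow> g \<in> V \<Longrightarrow> (\<lambda>w. f w + t * g w) \<in> V"
    and meas: "\<And>f. f \<in> V \<Longrightarrow> {w. av (f w) \<le> 1} \<in> sets M"
    and C: "C \<in> sets M"
    and eq: "\<And>f. f \<in> V \<Longrightarrow> measure M (C \<inter> {w. av (f w) \<le> 1}) = measure N (C \<inter> {w. av (f w) \<le> 1})"
    and f: "f \<in> V" and g: "g \<in> V"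
  shows "measure M (C \<inter> ({w. av (f w) \<le> 1} \<inter> {w. av (g w) \<le> 1}))
    = measure N (C \<inter> ({w. av (f w) \<le> 1} \<inter> {w. av (g w) \<le> 1}))"
proof -
  interpret M: finite_measure M by fact
  interpret N: finite_measure N by fact
  obtain p where p: "uniformizer p" using ex_uniformizer by (auto simp: uniformizer_def)
  then have p': "0 < av p" "av p < 1" by (auto simp: uniformizer_def)
  obtain R where R: "net (av p) R" using ex_net[of "av p"] p' by auto
  let ?Q = "real (card R)"
  \<comment> \<open>The residue field separates 0 from 1.\<close>
  have Q: "?Q \<ge> 2"
  proof -
    obtain s t where st: "s \<in> R" "av (0 - s) \<le> av p" "t \<in> R" "av (1 - t) \<le> av p"
      using net_covers[OF R, of 0] net_covers[OF R, of 1] by auto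
    then have "s \<noteq> t" using dist_ultra[of 1 0 t] p' dist_commute[of t 0] by auto
    then have "card {s, t} \<le> card R" using st net_finite[OF R] by (intro card_mono) auto
    then show ?thesis using \<open>s \<noteq> t\<close> by simp
  qed
  \<comment> \<open>\<open>t * f w\<close> is \<open>f w + (t - 1) * f w\<close>, which fits the
    single closure property of \<open>V\<close>.\<close>
  have scale: "(\<lambda>w. t * f w) \<in> V" if "f \<in> V" for f t
    using V[OF that that, of "t - 1"] by (simp add: algebra_simps)
  define d where "d f = measure M (C \<inter> ({w. av (f w) \<le> 1} \<inter> {w. av (g w) \<le> 1}))
    - measure N (C \<inter> ({w. av (f w) \<le> 1} \<inter> {w. av (g w) \<le> 1}))" for f
  have step: "?Q * d f = d (\<lambda>w. p * f w)" if f: "f \<in> V" for f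
  proof -
    define G where "G k = {w. av (p ^ k * g w) \<le> 1}" for k :: nat
    have G: "G k \<in> sets M" for k unfolding G_def by (intro meas scale g)
    have space: "space N = space M" using sets by (rule sets_eq_imp_space_eq)
    have bound: "\<bar>?Q * d f - d (\<lambda>w. p * f w)\<bar>
      \<le> (?Q + 1) * (measure M (space M - G k) + measure N (space M - G k))" for k
    proof -
      obtain S where S: "net (av p ^ k) S"
        using ex_net[of "av p ^ k"] p' by (auto simp: power_le_one)
      have "card S \<noteq> 0"
        using net_covers[OF S, of 0] net_finite[OF S] by auto
      then have S0: "real (card S) > 0" by simp
      have sums: "(\<Sum>t\<in>S. measure M (C \<inter> {w. av (f w + t * g w) \<le> 1}))
          = (\<Sum>t\<in>S. measure N (C \<inter> {w. av (f w + t * g w) \<le> 1}))"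
        "(\<Sum>t\<in>S. measure M (C \<inter> {w. av (p * (f w + t * g w)) \<le> 1}))
          = (\<Sum>t\<in>S. measure N (C \<inter> {w. av (p * (f w + t * g w)) \<le> 1}))"
        by (intro sum.cong refl eq V f g scale)+
      note m = meas[OF V[OF f g]] meas[OF scale[OF V[OF f g]]] meas[OF scale[OF g]]
        meas[OF g] meas[OF f] meas[OF scale[OF f]]
      have "real (card S) * \<bar>?Q * d f - d (\<lambda>w. p * f w)\<bar>
          = \<bar>real (card S) * (?Q * d f - d (\<lambda>w. p * f w))\<bar>" by (simp add: abs_mult)
      also have "\<dots> \<le> (?Q + 1) * card S * measure M (space M - G k)
          + (?Q + 1) * card S * measure N (space M - G k)"
        using net_measure_bound[OF \<open>finite_measure M\<close> p R S C m]
          net_measure_bound[OF \<open>finite_measure N\<close> p R S, unfolded sets, OF C m]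
        unfolding sums d_def G_def space right_diff_distrib by linarith
      also have "\<dots> = card S * ((?Q + 1) * (measure M (space M - G k) + measure N (space M - G k)))"
        by (simp add: algebra_simps)
      finally show ?thesis using S0 by (simp add: mult_le_cancel_left_pos)
    qed
    \<comment> \<open>The sets \<open>G k\<close> increase to the whole space because
      \<open>p ^ k * g w\<close> tends to 0 at every point.\<close>
    have lim: "(\<lambda>k. measure L (space M - G k)) \<longlonglongrightarrow> 0"
      if "finite_measure L" "sets L = sets M" for L
    proof -
      interpret L: finite_measure L by fact
      have "av (p ^ Suc k * x) \<le> av (p ^ k * x)" for k x
        using p' by (auto intro!: mult_right_mono mult_left_le_one_le)
      then have "decseq (\<lambda>k. space M - G k)"
        unfolding decseq_Suc_iff G_def by (blast intro: order_trans)
      then have "(\<lambda>k. measure L (space M - G k)) \<longlonglongrightarrow> measure L (\<Inter>k. space M - G k)"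
        using G that by (intro L.finite_Lim_measure_decseq) auto
      moreover have "(\<Inter>k. space M - G k) = {}"
      proof (rule equals0I)
        fix w assume w: "w \<in> (\<Inter>k. space M - G k)"
        have "(\<lambda>k. av p ^ k * av (g w)) \<longlonglongrightarrow> 0 * av (g w)"
          using p' by (intro tendsto_mult_right LIMSEQ_realpow_zero) auto
        then have "\<forall>\<^sub>F k in sequentially. av p ^ k * av (g w) < 1"
          by (intro order_tendstoD(2)[where y = "0 * av (g w)"]) auto
        then obtain k where "av p ^ k * av (g w) < 1"
          using eventually_happens' sequentially_bot by blast
        then have "w \<in> G k" by (simp add: G_def)
        then show False using w by blast
      qed
      ultimately show ?thesis by (simp only: measure_empty)
    qed
    have "(\<lambda>k. (?Q + 1) * (measure M (space M - G k) + measure N (space M - G k)))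
      \<longlonglongrightarrow> (?Q + 1) * (0 + 0)"
      using sets by (intro tendsto_mult_left tendsto_add lim assms) auto
    then have "\<bar>?Q * d f - d (\<lambda>w. p * f w)\<bar> \<le> (?Q + 1) * (0 + 0)"
      by (rule LIMSEQ_le_const) (use bound in auto)
    then show ?thesis by simp
  qed
  have iter: "?Q ^ n * d f = d (\<lambda>w. p ^ n * f w)" for n
  proof (induction n)
    case (Suc n)
    show ?case
      using step[OF scale[OF f, of "p ^ n"]] Suc by (simp add: mult.assoc)
  qed simp
  define b where "b = measure M (space M) + measure N (space N)"
  have "\<bar>d h\<bar> \<le> b" for h
    unfolding d_def b_def
    using M.bounded_measure N.bounded_measure
    by (smt (verit) measure_nonneg)
  then have b: "?Q ^ n * \<bar>d f\<bar> \<le> b" for n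
    using iter[of n] by (metis abs_mult abs_of_nonneg of_nat_0_le_iff power_abs)
  have "d f = 0"
  proof (rule ccontr)
    assume "d f \<noteq> 0"
    moreover obtain n where "b / \<bar>d f\<bar> < ?Q ^ n"
      using real_arch_pow[of ?Q "b / \<bar>d f\<bar>"] Q by auto
    ultimately have "b < ?Q ^ n * \<bar>d f\<bar>" by (simp add: divide_less_eq)
    then show False using b[of n] by simp
  qed
  then show ?thesis by (simp add: d_def)
qed

theorem cramer_wold_finite:
  fixes M N :: "'e measure" and V :: "('e \<Rightarrow> 'a) set"
  assumes MN: "finite_measure M" "finite_measure N" "sets N = sets M"
    and V: "\<And>f g t. f \<in> V \<Longrightarrow> g \<in> V \<Longrightarrow> (\<lambda>w. f w + t * g w) \<in> V"
    and meas: "\<And>f. f \<in> V \<Longrightarrow> {w. av (f w) \<le> 1} \<in> sets M"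
    and eq: "\<And>f. f \<in> V \<Longrightarrow> measure M {w. av (f w) \<le> 1} = measure N {w. av (f w) \<le> 1}"
    and "finite F" "F \<subseteq> V" "F \<noteq> {}"
  shows "measure M {w. \<forall>f\<in>F. av (f w) \<le> 1} = measure N {w. \<forall>f\<in>F. av (f w) \<le> 1}"
proof -
  have sets: "{w. \<forall>f\<in>F. av (f w) \<le> 1} \<in> sets M" if "finite F" "F \<noteq> {}" "F \<subseteq> V" for F
  proof -
    have "{w. \<forall>f\<in>F. av (f w) \<le> 1} = (\<Inter>f\<in>F. {w. av (f w) \<le> 1})" by auto
    also have "\<dots> \<in> sets M" using that meas by (intro sets.finite_INT) auto
    finally show ?thesis .
  qed
  \<comment> \<open>One further strip \<open>g\<close> is kept free: the induction hypothesis then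
    has the form of the assumption \<open>eq\<close> of \<open>measure_pair_eqI\<close>, with the
    cylinder over \<open>F\<close> as \<open>C\<close>.\<close>
  have "\<forall>g\<in>V. measure M ({w. \<forall>f\<in>F. av (f w) \<le> 1} \<inter> {w. av (g w) \<le> 1})
    = measure N ({w. \<forall>f\<in>F. av (f w) \<le> 1} \<inter> {w. av (g w) \<le> 1})"
    using \<open>finite F\<close> \<open>F \<noteq> {}\<close> \<open>F \<subseteq> V\<close>
  proof (induction F rule: finite_ne_induct)
    case (singleton f)
    have eq': "measure M (space M \<inter> {w. av (h w) \<le> 1}) = measure N (space M \<inter> {w. av (h w) \<le> 1})"
      if "h \<in> V" for h
      using eq[OF that] meas[OF that] by (simp add: sets.Int_space_eq1)
    show ?case
    proof
      fix g assume g: "g \<in> V"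
      have f: "f \<in> V" using singleton by simp
      have 1: "space M \<inter> ({w. av (f w) \<le> 1} \<inter> {w. av (g w) \<le> 1})
        = {w. av (f w) \<le> 1} \<inter> {w. av (g w) \<le> 1}"
        by (intro sets.Int_space_eq1 sets.Int meas f g)
      have 2: "{w. \<forall>h\<in>{f}. av (h w) \<le> 1} = {w. av (f w) \<le> 1}" by simp
      show "measure M ({w. \<forall>f\<in>{f}. av (f w) \<le> 1} \<inter> {w. av (g w) \<le> 1})
        = measure N ({w. \<forall>f\<in>{f}. av (f w) \<le> 1} \<inter> {w. av (g w) \<le> 1})"
        unfolding 2 by (rule measure_pair_eqI[OF MN V meas sets.top eq' f g, unfolded 1])
    qed
  next
    case (insert f F)
    have *: "{w. \<forall>f\<in>F. av (f w) \<le> 1} \<inter> ({w. av (f w) \<le> 1} \<inter> {w. av (g w) \<le> 1})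
      = {w. \<forall>f\<in>insert f F. av (f w) \<le> 1} \<inter> {w. av (g w) \<le> 1}" for g by auto
    have "measure M ({w. \<forall>f\<in>F. av (f w) \<le> 1} \<inter> ({w. av (f w) \<le> 1} \<inter> {w. av (g w) \<le> 1}))
      = measure N ({w. \<forall>f\<in>F. av (f w) \<le> 1} \<inter> ({w. av (f w) \<le> 1} \<inter> {w. av (g w) \<le> 1}))"
      if "g \<in> V" for g
    proof (rule measure_pair_eqI[where V = V and M = M and N = N and C = "{w. \<forall>f\<in>F. av (f w) \<le> 1}" and f = f and g = g])
      show "f \<in> V" using insert.prems by blast
      show "{w. \<forall>f\<in>F. av (f w) \<le> 1} \<in> sets M"
        using sets[OF insert.hyps(1,2)] insert.prems by blast
      fix h assume "h \<in> V"
      then show "measure M ({w. \<forall>f\<in>F. av (f w) \<le> 1} \<inter> {w. av (h w) \<le> 1})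
        = measure N ({w. \<forall>f\<in>F. av (f w) \<le> 1} \<inter> {w. av (h w) \<le> 1})"
        using insert.IH insert.prems by blast
    qed (fact MN V meas that)+
    then show ?case unfolding * by blast
  qed
  note pair = this
  \<comment> \<open>Choosing the free strip among those of \<open>F\<close> makes it
    disappear.\<close>
  obtain g where g: "g \<in> F" using \<open>F \<noteq> {}\<close> by auto
  then have "{w. \<forall>f\<in>F. av (f w) \<le> 1} \<inter> {w. av (g w) \<le> 1} = {w. \<forall>f\<in>F. av (f w) \<le> 1}"
    by auto
  moreover have "g \<in> V" using g \<open>F \<subseteq> V\<close> by blast
  ultimately show ?thesis using bspec[OF pair, of g] by simp
qed

end

section \<open>Normed spaces over a local field\<close>

locale separable_normed_space = nonarch_local_field av
  for av :: "'k::field \<Rightarrow> real" +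
  fixes sc :: "'k \<Rightarrow> 'e::ab_group_add \<Rightarrow> 'e" and nm :: "'e \<Rightarrow> real"
  assumes normed: "normed_space_K av sc nm"
    and nm_separable: "separable_space (norm_top nm)"
begin

sublocale vector_space sc
  using normed by (simp add: normed_space_K_def)

lemma nm_scale [simp]: "nm (sc a x) = av a * nm x"
  using normed by (simp add: normed_space_K_def)

sublocale nm: separable_ultranorm nm
proof unfold_locales
  show "nm (- x) = nm x" for x
    using nm_scale[of "- 1" x] by simp
qed (use normed nm_separable in \<open>auto simp: normed_space_K_def\<close>)

section \<open>Continuous linear functionals\<close>

abbreviation dual :: "('e \<Rightarrow> 'k) set" where
  "dual \<equiv> dual_space_K av sc nm"

lemma dual_iff:
  "T \<in> dual \<longleftrightarrow> (\<forall>x y. T (x + y) = T x + T y) \<and> (\<forall>c x. T (sc c x) = c * T x) \<and>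
     (\<forall>e>0. \<exists>d>0. \<forall>x. nm x < d \<longrightarrow> av (T x) < e)"
proof -
  have lin: "Vector_Spaces.linear sc (*) T \<longleftrightarrow>
    (\<forall>x y. T (x + y) = T x + T y) \<and> (\<forall>c x. T (sc c x) = c * T x)"
  proof -
    have "vector_space ((*) :: 'k \<Rightarrow> 'k \<Rightarrow> 'k)"
      by unfold_locales (simp_all add: algebra_simps)
    then show ?thesis
      using vector_space_axioms by (auto simp: Vector_Spaces.linear_iff)
  qed
  have cont: "continuous_map (norm_top nm) (norm_top av) T \<longleftrightarrow> (\<forall>e>0. \<exists>d>0. \<forall>x. nm x < d \<longrightarrow> av (T x) < e)"
    if T: "\<And>x y. T (x + y) = T x + T y"
  proof
    assume "continuous_map (norm_top nm) (norm_top av) T"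
    then have op: "openin (norm_top nm) {x. T x \<in> U}" if "openin (norm_top av) U" for U
      using that by (auto simp: continuous_map)
    show "\<forall>e>0. \<exists>d>0. \<forall>x. nm x < d \<longrightarrow> av (T x) < e"
    proof (intro allI impI)
      fix e :: real assume "e > 0"
      moreover have "T 0 = 0" using T[of 0 0] by (metis add_0 add_right_imp_eq)
      ultimately have "0 \<in> {x. T x \<in> {y. av (y - 0) < e}}" by simp
      from bspec[OF op[OF openin_ball[of 0 e], unfolded nm.openin_norm_top] this]
      show "\<exists>d>0. \<forall>x. nm x < d \<longrightarrow> av (T x) < e" by simp
    qed
  next
    assume e: "\<forall>e>0. \<exists>d>0. \<forall>x. nm x < d \<longrightarrow> av (T x) < e"
    have diff: "T x - T y = T (x - y)" for x y
      using T[of "x - y" y] by simp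
    show "continuous_map (norm_top nm) (norm_top av) T"
      unfolding continuous_map
    proof (intro conjI allI impI)
      fix U assume U: "openin (norm_top av) U"
      show "openin (norm_top nm) {x \<in> topspace (norm_top nm). T x \<in> U}"
        unfolding nm.openin_norm_top
      proof
        fix x assume "x \<in> {x \<in> topspace (norm_top nm). T x \<in> U}"
        then obtain r where r: "r > 0" "\<And>y. av (y - T x) < r \<Longrightarrow> y \<in> U"
          using U unfolding openin_norm_top by blast
        then obtain d where d: "d > 0" "\<And>y. nm y < d \<Longrightarrow> av (T y) < r" using e by blast
        have "T y \<in> U" if "nm (y - x) < d" for y
          using r(2)[of "T y"] d(2)[OF that] by (simp add: diff)
        then show "\<exists>r>0. \<forall>y. nm (y - x) < r \<longrightarrow> y \<in> {x \<in> topspace (norm_top nm). T x \<in> U}"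
          using d(1) by auto
      qed
    qed auto
  qed
  show ?thesis
    unfolding dual_space_K_def norm_top_def[of av, symmetric] using lin cont by blast
qed

lemma dual_add: "T \<in> dual \<Longrightarrow> T (x + y) = T x + T y"
  and dual_scale: "T \<in> dual \<Longrightarrow> T (sc c x) = c * T x"
  and dual_continuous: "T \<in> dual \<Longrightarrow> 0 < e \<Longrightarrow> \<exists>d>0. \<forall>x. nm x < d \<longrightarrow> av (T x) < e"
  by (auto simp: dual_iff)

lemma dual_diff: "T \<in> dual \<Longrightarrow> T (x - y) = T x - T y"
  using dual_add[of T "x - y" y] by simp

lemma dual_measurable: "T \<in> dual \<Longrightarrow> T \<in> measurable (borel_norm nm) (borel_norm av)"
  by (rule nm.continuous_map_norm_top_measurable[OF ultranorm_axioms])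
    (simp add: dual_space_K_def norm_top_def)

lemma dual_combine:
  assumes T: "T \<in> dual" and T': "T' \<in> dual"
  shows "(\<lambda>x. T x + c * T' x) \<in> dual"
  unfolding dual_iff
proof (intro conjI allI impI)
  fix e :: real assume e: "e > 0"
  obtain d where d: "d > 0" "\<And>x. nm x < d \<Longrightarrow> av (T x) < e"
    using dual_continuous[OF T e] by blast
  \<comment> \<open>The summand 1 keeps the denominator positive when \<open>c = 0\<close>.\<close>
  have "e / (av c + 1) > 0" using e nonneg[of c] by (intro divide_pos_pos) linarith+
  then obtain d' where d': "d' > 0" "\<And>x. nm x < d' \<Longrightarrow> av (T' x) < e / (av c + 1)"
    using dual_continuous[OF T'] by blast
  have "av (T x + c * T' x) < e" if "nm x < min d d'" for x
  proof -
    have "av c * av (T' x) \<le> (av c + 1) * av (T' x)" by (simp add: algebra_simps)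
    also have "\<dots> < e" using d'(2)[of x] that nonneg[of c] by (simp add: field_simps)
    finally show ?thesis using ultra[of "T x" "c * T' x"] d(2)[of x] that by simp
  qed
  then show "\<exists>d>0. \<forall>x. nm x < d \<longrightarrow> av (T x + c * T' x) < e"
    using d d' by (intro exI[of _ "min d d'"]) auto
qed (use T T' in \<open>auto simp: dual_add dual_scale algebra_simps\<close>)

lemma dual_smult: "T \<in> dual \<Longrightarrow> (\<lambda>x. c * T x) \<in> dual"
  using dual_combine[of T T "c - 1"] by (simp add: algebra_simps)

text \<open>Ingleton's form of the Hahn--Banach theorem. Functionals on subspaces are represented by
  their graphs; the norm bound alone makes such a graph single-valued.\<close>

definition dominated_graph :: "'e \<Rightarrow> ('e \<times> 'k) set \<Rightarrow> bool" where
  "dominated_graph x0 G \<longleftrightarrow> (x0, 1) \<in> G \<and>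
     (\<forall>x k y l. (x, k) \<in> G \<longrightarrow> (y, l) \<in> G \<longrightarrow> (x + y, k + l) \<in> G) \<and>
     (\<forall>c x k. (x, k) \<in> G \<longrightarrow> (sc c x, c * k) \<in> G) \<and>
     (\<forall>x k. (x, k) \<in> G \<longrightarrow> av k * nm x0 \<le> nm x)"

context
  fixes x0 G
  assumes G: "dominated_graph x0 G"
begin

lemma graph_base: "(x0, 1) \<in> G"
  and graph_add: "(x, k) \<in> G \<Longrightarrow> (y, l) \<in> G \<Longrightarrow> (x + y, k + l) \<in> G"
  and graph_scale: "(x, k) \<in> G \<Longrightarrow> (sc c x, c * k) \<in> G"
  and graph_bound: "(x, k) \<in> G \<Longrightarrow> av k * nm x0 \<le> nm x"
  using G unfolding dominated_graph_def by blast+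

lemma graph_diff: "(x, k) \<in> G \<Longrightarrow> (y, l) \<in> G \<Longrightarrow> (x - y, k - l) \<in> G"
  using graph_add[OF _ graph_scale[of y l "- 1"], of x k] by simp

lemma graph_unique:
  assumes "x0 \<noteq> 0" "(x, k) \<in> G" "(x, l) \<in> G"
  shows "k = l"
proof -
  have "av (k - l) * nm x0 \<le> 0" using graph_bound[OF graph_diff[OF assms(2,3)]] by simp
  moreover have "nm x0 > 0" using assms(1) nm.nonneg[of x0] nm.eq_0[of x0] by linarith
  ultimately have "av (k - l) \<le> 0" by (simp add: mult_le_0_iff)
  then have "av (k - l) = 0" using nonneg[of "k - l"] by linarith
  then show ?thesis by simp
qed

text \<open>An admissible value \<open>v\<close> at \<open>x\<close> must satisfy
  \<open>av (v + k) \<le> nm (x + d) / nm x0\<close> for all \<open>(d, k)\<close> in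
  \<open>G\<close>, that is, lie in a family of balls centred at the points \<open>- k\<close>. The
  bound on \<open>G\<close> at differences makes them meet pairwise, so spherical completeness
  yields \<open>v\<close>. If \<open>x\<close> is already in the domain, the bound forces the old
  value.\<close>

lemma graph_extend:
  assumes "x0 \<noteq> 0"
  shows "\<exists>G' v. dominated_graph x0 G' \<and> G \<subseteq> G' \<and> (x, v) \<in> G'"
proof -
  have n0: "nm x0 > 0" using assms nm.nonneg[of x0] nm.eq_0[of x0] by linarith
  have "\<exists>v. \<forall>(c, r)\<in>{(- k, nm (x + d) / nm x0) | d k. (d, k) \<in> G}. av (v - c) \<le> r"
  proof (rule cballs_Inter_nonempty)
    fix a r b s
    assume "(a, r) \<in> {(- k, nm (x + d) / nm x0) | d k. (d, k) \<in> G}"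
      "(b, s) \<in> {(- k, nm (x + d) / nm x0) | d k. (d, k) \<in> G}"
    then obtain d k d' k' where *: "a = - k" "r = nm (x + d) / nm x0" "(d, k) \<in> G"
      "b = - k'" "s = nm (x + d') / nm x0" "(d', k') \<in> G" by blast
    have "av (a - b) * nm x0 \<le> nm (d' - d)"
      using graph_bound[OF graph_diff[OF *(6,3)]] * by simp
    also have "\<dots> \<le> max (nm (x + d')) (nm (x + d))"
      using nm.ultra_diff[of "x + d'" "x + d"] by simp
    also have "\<dots> = max r s * nm x0"
      unfolding *(2,5) using n0 by (subst max_mult_distrib_right) (auto simp: max.commute)
    finally show "av (a - b) \<le> max r s" using n0 by simp
  qed
  then obtain v where v: "\<And>d k. (d, k) \<in> G \<Longrightarrow> av (v + k) \<le> nm (x + d) / nm x0"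
    by fastforce
  let ?G = "{(d + sc c x, k + c * v) | d k c. (d, k) \<in> G}"
  \<comment> \<open>For \<open>c \<noteq> 0\<close>, dividing by \<open>c\<close> reduces this to
    the choice of \<open>v\<close> at the point \<open>sc (inverse c) d\<close>.\<close>
  have bound: "av (k + c * v) * nm x0 \<le> nm (d + sc c x)" if "(d, k) \<in> G" for d k c
  proof (cases "c = 0")
    case True
    then show ?thesis using graph_bound[OF that] by simp
  next
    case False
    have "av (v + inverse c * k) * nm x0 \<le> nm (x + sc (inverse c) d)"
      using v[OF graph_scale[OF that, of "inverse c"]] n0 by (simp add: le_divide_eq)
    then have "av c * (av (v + inverse c * k) * nm x0) \<le> av c * nm (x + sc (inverse c) d)"
      by (rule mult_left_mono) simp
    moreover have "c * (v + inverse c * k) = k + c * v" "sc c (x + sc (inverse c) d) = d + sc c x"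
      using False by (auto simp: algebra_simps)
    ultimately show ?thesis by (metis mult nm_scale mult.assoc)
  qed
  have sub: "z \<in> ?G" if "z \<in> G" for z
    using that by (cases z) (intro CollectI exI[of _ "fst z"] exI[of _ "snd z"] exI[of _ 0], auto)
  have add: "(p + q, k + l) \<in> ?G" if pq: "(p, k) \<in> ?G" "(q, l) \<in> ?G" for p k q l
  proof -
    obtain d i c where 1: "p = d + sc c x" "k = i + c * v" "(d, i) \<in> G" using pq(1) by blast
    obtain d' i' c' where 2: "q = d' + sc c' x" "l = i' + c' * v" "(d', i') \<in> G" using pq(2) by blast
    show ?thesis
      by (rule CollectI, rule exI[of _ "d + d'"], rule exI[of _ "i + i'"], rule exI[of _ "c + c'"])
        (use graph_add[OF 1(3) 2(3)] 1 2 in \<open>simp add: algebra_simps\<close>)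
  qed
  have scale: "(sc a p, a * k) \<in> ?G" if pq: "(p, k) \<in> ?G" for a p k
  proof -
    obtain d i c where 1: "p = d + sc c x" "k = i + c * v" "(d, i) \<in> G" using pq by blast
    show ?thesis
      by (rule CollectI, rule exI[of _ "sc a d"], rule exI[of _ "a * i"], rule exI[of _ "a * c"])
        (use graph_scale[OF 1(3)] 1 in \<open>simp add: algebra_simps\<close>)
  qed
  have "dominated_graph x0 ?G"
    unfolding dominated_graph_def
  proof (intro conjI allI impI)
    show "(x0, 1) \<in> ?G" by (rule sub[OF graph_base])
    fix y l assume "(y, l) \<in> ?G"
    then obtain d k c where "y = d + sc c x" "l = k + c * v" "(d, k) \<in> G" by blast
    then show "av l * nm x0 \<le> nm y" using bound by simp
  qed (fact add scale)+
  moreover have "(x, v) \<in> ?G"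
    using graph_scale[OF graph_base, of 0]
    by (intro CollectI exI[of _ 0] exI[of _ 0] exI[of _ 1]) auto
  ultimately show ?thesis using sub by (intro exI[of _ ?G] exI[of _ v]) (rule conjI, assumption, rule conjI, rule subsetI, assumption+)
qed

end

theorem hahn_banach:
  assumes "x0 \<noteq> 0"
  shows "\<exists>T\<in>dual. T x0 = 1 \<and> (\<forall>x. av (T x) * nm x0 \<le> nm x)"
proof -
  let ?A = "{G. dominated_graph x0 G}"
  have "\<exists>G\<in>?A. \<forall>H\<in>?A. G \<subseteq> H \<longrightarrow> H = G"
  proof (rule subset_Zorn_nonempty)
    \<comment> \<open>The functional \<open>sc c x0 \<mapsto> c\<close> on the line through
      \<open>x0\<close> is the starting point; it meets the bound with equality.\<close>
    have "dominated_graph x0 (range (\<lambda>c. (sc c x0, c)))"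
      unfolding dominated_graph_def
      by (auto simp: image_iff scale_left_distrib intro!: exI[of _ 1])
    then show "?A \<noteq> {}" by blast
  next
    fix \<C> assume C: "\<C> \<noteq> {}" "subset.chain ?A \<C>"
    then have dg: "dominated_graph x0 G" if "G \<in> \<C>" for G
      using that by (auto simp: subset.chain_def)
    have "(x + y, k + l) \<in> \<Union>\<C>" if xy: "(x, k) \<in> \<Union>\<C>" "(y, l) \<in> \<Union>\<C>" for x k y l
    proof -
      obtain G H where GH: "G \<in> \<C>" "H \<in> \<C>" "(x, k) \<in> G" "(y, l) \<in> H" using xy by blast
      then have "G \<subseteq> H \<or> H \<subseteq> G" using C(2) by (auto simp: subset.chain_def)
      then show ?thesis using GH graph_add[OF dg] by (meson UnionI subsetD)
    qed
    moreover have "(x0, 1) \<in> \<Union>\<C>" using C(1) graph_base[OF dg] by blast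
    moreover have "(sc c x, c * k) \<in> \<Union>\<C>" if "(x, k) \<in> \<Union>\<C>" for c x k
      using that graph_scale[OF dg] by blast
    moreover have "av k * nm x0 \<le> nm x" if "(x, k) \<in> \<Union>\<C>" for x k
      using that graph_bound[OF dg] by blast
    ultimately show "\<Union>\<C> \<in> ?A" unfolding dominated_graph_def by blast
  qed
  then obtain G where G: "dominated_graph x0 G"
    and max: "\<And>H. dominated_graph x0 H \<Longrightarrow> G \<subseteq> H \<Longrightarrow> H = G" by blast
  \<comment> \<open>A maximal graph is total, since \<open>graph_extend\<close> gives a value at
    \<open>x\<close> without leaving \<open>G\<close>.\<close>
  have "\<exists>k. (x, k) \<in> G" for x
    using graph_extend[OF G assms, of x] max by metis
  then obtain T where T: "\<And>x. (x, T x) \<in> G" by metis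
  note eq = graph_unique[OF G assms]
  have bound: "av (T x) * nm x0 \<le> nm x" for x
    using graph_bound[OF G T] .
  have n0: "nm x0 > 0" using assms nm.nonneg[of x0] nm.eq_0[of x0] by linarith
  have "T \<in> dual"
    unfolding dual_iff
  proof (intro conjI allI impI)
    show "T (x + y) = T x + T y" for x y by (rule eq[OF T graph_add[OF G T T]])
    show "T (sc c x) = c * T x" for c x by (rule eq[OF T graph_scale[OF G T]])
    fix e :: real assume "e > 0"
    moreover have "av (T x) < e" if "nm x < e * nm x0" for x
      using le_less_trans[OF bound that] n0 by simp
    ultimately show "\<exists>d>0. \<forall>x. nm x < d \<longrightarrow> av (T x) < e"
      using n0 by (intro exI[of _ "e * nm x0"]) auto
  qed
  moreover have "T x0 = 1" by (rule eq[OF T graph_base[OF G]])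
  ultimately show ?thesis using bound by blast
qed

text \<open>The constants move the test balls away from 0, which linear functionals alone cannot do.
  Radii need no parameter, because \<open>T\<close> and \<open>b\<close> can be rescaled
  together.\<close>

definition affine :: "('e \<Rightarrow> 'k) set" where
  "affine = {\<lambda>x. T x + b | T b. T \<in> dual}"

lemma affineI: "T \<in> dual \<Longrightarrow> (\<lambda>x. T x + b) \<in> affine"
  unfolding affine_def by blast

lemma affine_combine:
  assumes "f \<in> affine" "g \<in> affine"
  shows "(\<lambda>x. f x + t * g x) \<in> affine"
proof -
  obtain T b T' b' where *: "T \<in> dual" "f = (\<lambda>x. T x + b)" "T' \<in> dual" "g = (\<lambda>x. T' x + b')"
    using assms unfolding affine_def by blast
  show ?thesis
    unfolding affine_def
    by (rule CollectI, rule exI[of _ "\<lambda>x. T x + t * T' x"], rule exI[of _ "b + t * b'"])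
      (use * dual_combine in \<open>auto simp: algebra_simps\<close>)
qed

lemma affine_cball_in_sets:
  assumes "f \<in> affine"
  shows "{x. av (f x) \<le> 1} \<in> sets (borel_norm nm)"
proof -
  obtain T b where T: "T \<in> dual" "f = (\<lambda>x. T x + b)" using assms unfolding affine_def by blast
  have "{y. av (y - (- b)) \<le> 1} \<in> sets (borel_norm av)" by (intro open_in_sets openin_cball) simp
  from measurable_sets[OF dual_measurable[OF T(1)] this] show ?thesis
    by (simp add: T(2) vimage_def)
qed

text \<open>The ball is a countable intersection of strips: by density, countably many norming
  functionals detect every point outside it.\<close>

lemma ball_in_sigma_affine:
  assumes S: "sigma_algebra UNIV S" and aff: "\<And>f. f \<in> affine \<Longrightarrow> {x. av (f x) \<le> 1} \<in> S"
  shows "{y. nm (y - a) < r} \<in> S"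
proof -
  interpret S: sigma_algebra UNIV S by fact
  show ?thesis
  proof (cases "r > 0")
    case False
    then have "{y. nm (y - a) < r} = {}" by (auto simp: not_less intro: order_trans[OF _ nm.nonneg])
    then show ?thesis by simp
  next
    case True
    obtain p where p: "uniformizer p" using ex_uniformizer by (auto simp: uniformizer_def)
    then have p': "p \<noteq> 0" "av p < 1" by (auto simp: uniformizer_def)
    obtain D where D: "countable D" "\<And>x r. r > 0 \<Longrightarrow> \<exists>d\<in>D. nm (x - d) < r"
      using nm.ex_countable_dense by blast
    let ?D = "{d \<in> D. r \<le> nm (d - a)}"
    have "\<forall>d\<in>?D. \<exists>T. T \<in> dual \<and> T (d - a) = 1 \<and> (\<forall>x. av (T x) * nm (d - a) \<le> nm x)"
    proof
      fix d assume "d \<in> ?D"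
      then have "d - a \<noteq> 0" using True by auto
      from hahn_banach[OF this]
      show "\<exists>T. T \<in> dual \<and> T (d - a) = 1 \<and> (\<forall>x. av (T x) * nm (d - a) \<le> nm x)" by blast
    qed
    from bchoice[OF this] obtain T where T: "\<And>d. d \<in> ?D \<Longrightarrow> T d \<in> dual"
      "\<And>d. d \<in> ?D \<Longrightarrow> T d (d - a) = 1"
      "\<And>d x. d \<in> ?D \<Longrightarrow> av (T d x) * nm (d - a) \<le> nm x" by blast
    have "{y. nm (y - a) < r} = (\<Inter>d\<in>?D. {y. av (T d (y - a)) < 1})"
    proof (rule subset_antisym; rule subsetI)
      fix y assume y: "y \<in> {y. nm (y - a) < r}"
      have "av (T d (y - a)) < 1" if d: "d \<in> ?D" for d
      proof -
        have "av (T d (y - a)) * nm (d - a) < 1 * nm (d - a)"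
          using T(3)[OF d, of "y - a"] y d unfolding mem_Collect_eq mult_1 by linarith
        then show ?thesis using d True by (subst (asm) mult_less_cancel_right_pos) auto
      qed
      then show "y \<in> (\<Inter>d\<in>?D. {y. av (T d (y - a)) < 1})" by blast
    next
      fix y assume y: "y \<in> (\<Inter>d\<in>?D. {y. av (T d (y - a)) < 1})"
      show "y \<in> {y. nm (y - a) < r}"
      proof (rule ccontr)
        assume "y \<notin> {y. nm (y - a) < r}"
        then have r: "r \<le> nm (y - a)" by simp
        then have "0 < nm (y - a)" using True by linarith
        \<comment> \<open>With \<open>d\<close> closer to \<open>y\<close> than \<open>a\<close> is,
          \<open>d - a\<close> and \<open>y - a\<close> have equal norm, and
          \<open>T d (y - a)\<close> differs from \<open>T d (d - a) = 1\<close> by an element of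
          value below 1.\<close>
        then obtain d where d: "d \<in> D" "nm (y - d) < nm (y - a)" using D(2) by blast
        then have eq: "nm (d - a) = nm (y - a)"
          using nm.add_less_absorb[of "d - y" "y - a"] nm.dist_commute[of d y] by simp
        with d r have dD: "d \<in> ?D" by simp
        have "av (T d (y - d)) * nm (d - a) < 1 * nm (d - a)"
          using T(3)[OF dD, of "y - d"] d(2) unfolding eq mult_1 by linarith
        then have "av (T d (y - d)) < 1" using eq r True by (subst (asm) mult_less_cancel_right_pos) auto
        moreover have "T d (y - a) = T d (y - d) + 1"
          using dual_add[OF T(1)[OF dD], of "y - d" "d - a"] T(2)[OF dD] by simp
        ultimately have "av (T d (y - a)) = 1" using add_less_absorb[of "T d (y - d)" 1] by simp
        then show False using y dD by auto
      qed
    qed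
    moreover have "(\<Inter>d\<in>?D. {y. av (T d (y - a)) < 1}) \<in> S"
    proof (rule S.countable_INT'')
      show "UNIV \<in> S" using S.top .
      show "countable ?D" using D(1) by auto
      fix d assume d: "d \<in> ?D"
      have "(\<lambda>y. inverse p * T d y + - inverse p * T d a) \<in> affine"
        by (rule affineI[OF dual_smult[OF T(1)[OF d]]])
      \<comment> \<open>Discreteness of values turns the strict inequality into
        \<open>\<le> av p\<close>, and division by \<open>p\<close> makes it a unit strip of an
        affine function.\<close>
      moreover have "av (T d (y - a)) < 1 \<longleftrightarrow> av (inverse p * T d y + - inverse p * T d a) \<le> 1" for y
      proof -
        have "inverse p * T d y + - inverse p * T d a = inverse p * T d (y - a)"
          unfolding dual_diff[OF T(1)[OF d]] by (simp add: algebra_simps)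
        then have "av (inverse p * T d y + - inverse p * T d a) = av (T d (y - a)) / av p"
          by (simp only: mult inverse) (simp add: divide_inverse mult.commute)
        moreover have "av (T d (y - a)) < 1 \<longleftrightarrow> av (T d (y - a)) \<le> av p"
          using p p' by (auto simp: uniformizer_def)
        ultimately show ?thesis using p' by (simp add: divide_le_eq)
      qed
      ultimately show "{y. av (T d (y - a)) < 1} \<in> S" using aff by simp
    qed
    ultimately show ?thesis by simp
  qed
qed

text \<open>Finite intersections of unit strips are stable under intersection and generate the Borel
  sets; \<open>cramer_wold_finite\<close> gives equality on them.\<close>

theorem law_eqI:
  assumes "finite_measure M" "finite_measure N"
    and M: "sets M = sets (borel_norm nm)" and N: "sets N = sets (borel_norm nm)"
    and eq: "\<And>T b. T \<in> dual \<Longrightarrow> measure M {x. av (T x + b) \<le> 1} = measure N {x. av (T x + b) \<le> 1}"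
  shows "M = N"
proof -
  interpret M: finite_measure M by fact
  interpret N: finite_measure N by fact
  define cyl where "cyl F = {x. \<forall>f\<in>F. av (f x) \<le> 1}" for F :: "('e \<Rightarrow> 'k) set"
  let ?E = "{cyl F | F. finite F \<and> F \<noteq> {} \<and> F \<subseteq> affine}"
  have cyl_sets: "cyl F \<in> sets (borel_norm nm)" if "finite F" "F \<noteq> {}" "F \<subseteq> affine" for F
  proof -
    have "cyl F = (\<Inter>f\<in>F. {x. av (f x) \<le> 1})" by (auto simp: cyl_def)
    also have "\<dots> \<in> sets (borel_norm nm)"
      using that affine_cball_in_sets by (intro sets.finite_INT) auto
    finally show ?thesis .
  qed
  have single: "{x. av (f x) \<le> 1} \<in> ?E" if "f \<in> affine" for f
    by (rule CollectI, rule exI[of _ "{f}"]) (use that in \<open>auto simp: cyl_def\<close>)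
  have sig: "sets (borel_norm nm) = sigma_sets UNIV ?E"
  proof
    show "sigma_sets UNIV ?E \<subseteq> sets (borel_norm nm)"
      using cyl_sets sets.sigma_sets_subset[of ?E "borel_norm nm"] by auto
    have alg: "sigma_algebra UNIV (sigma_sets UNIV ?E)" by (rule sigma_algebra_sigma_sets) auto
    have ball: "{y. nm (y - a) < r} \<in> sigma_sets UNIV ?E" for a r
      by (rule ball_in_sigma_affine[OF alg]) (rule sigma_sets.Basic[OF single])
    obtain \<B> where B: "countable \<B>" "\<And>B. B \<in> \<B> \<Longrightarrow> \<exists>x r. 0 < r \<and> B = {y. nm (y - x) < r}"
      "\<And>x r. r > 0 \<Longrightarrow> \<exists>B\<in>\<B>. x \<in> B \<and> (\<forall>y\<in>B. nm (y - x) < r)"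
      using nm.countable_ball_base by metis
    have "U \<in> sigma_sets UNIV ?E" if U: "openin (norm_top nm) U" for U
    proof -
      have "U = (\<Union>B\<in>{B \<in> \<B>. B \<subseteq> U}. B)"
      proof (rule subset_antisym; rule subsetI)
        fix x assume "x \<in> U"
        then obtain r where r: "r > 0" "\<And>y. nm (y - x) < r \<Longrightarrow> y \<in> U"
          using U unfolding nm.openin_norm_top by blast
        obtain B where "B \<in> \<B>" "x \<in> B" "\<forall>y\<in>B. nm (y - x) < r" using B(3)[OF r(1), of x] by blast
        then show "x \<in> (\<Union>B\<in>{B \<in> \<B>. B \<subseteq> U}. B)" using r(2) by blast
      qed auto
      also have "\<dots> \<in> sigma_sets UNIV ?E"
      proof (rule sigma_algebra.countable_UN'[OF alg])
        show "countable {B \<in> \<B>. B \<subseteq> U}" using B(1) by auto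
        show "(\<lambda>B. B) ` {B \<in> \<B>. B \<subseteq> U} \<subseteq> sigma_sets UNIV ?E"
        proof (rule image_subsetI)
          fix A assume "A \<in> {B \<in> \<B>. B \<subseteq> U}"
          then obtain x r where "A = {y. nm (y - x) < r}" using B(2) by blast
          then show "A \<in> sigma_sets UNIV ?E" using ball by simp
        qed
      qed
      finally show ?thesis .
    qed
    then show "sets (borel_norm nm) \<subseteq> sigma_sets UNIV ?E"
      unfolding nm.sets_borel_norm by (intro sigma_sets_mono) auto
  qed
  \<comment> \<open>The strip of the zero function is the whole space, which serves as the
    exhausting sequence.\<close>
  have zero: "(\<lambda>x. 0) \<in> affine"
  proof -
    have "(\<lambda>x. 0) \<in> dual" unfolding dual_iff by (simp add: gt_ex)
    then show ?thesis unfolding affine_def by (intro CollectI exI[of _ "\<lambda>x. 0"] exI[of _ 0]) auto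
  qed
  show ?thesis
  proof (rule measure_eqI_generator_eq[where E = ?E and \<Omega> = UNIV and A = "\<lambda>_. UNIV"])
    show "Int_stable ?E"
    proof (rule Int_stableI)
      fix a b assume "a \<in> ?E" "b \<in> ?E"
      then obtain F F' where F: "a = cyl F" "finite F" "F \<noteq> {}" "F \<subseteq> affine"
        "b = cyl F'" "finite F'" "F' \<noteq> {}" "F' \<subseteq> affine" by blast
      have "a \<inter> b = cyl (F \<union> F')" using F by (auto simp: cyl_def)
      then show "a \<inter> b \<in> ?E" using F by (intro CollectI exI[of _ "F \<union> F'"]) auto
    qed
    show "emeasure M X = emeasure N X" if X: "X \<in> ?E" for X
    proof -
      obtain F where F: "X = cyl F" "finite F" "F \<noteq> {}" "F \<subseteq> affine" using X by blast
      have "measure M (cyl F) = measure N (cyl F)"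
        unfolding cyl_def
      proof (rule cramer_wold_finite[where V = affine and M = M and N = N and F = F])
        fix f assume "f \<in> affine"
        then obtain T b where "T \<in> dual" "f = (\<lambda>x. T x + b)" unfolding affine_def by blast
        then show "measure M {w. av (f w) \<le> 1} = measure N {w. av (f w) \<le> 1}" using eq by simp
      qed (use assms F affine_combine affine_cball_in_sets in auto)
      then show ?thesis using F by (simp add: M.emeasure_eq_measure N.emeasure_eq_measure)
    qed
    show "range (\<lambda>_. UNIV) \<subseteq> ?E" using single[OF zero] by simp
  qed (use M N sig in auto)
qed

end

section \<open>Gaussian laws\<close>

context separable_normed_space
begin

abbreviation lin2 :: "'k \<Rightarrow> 'k \<Rightarrow> 'k \<Rightarrow> 'k \<Rightarrow> 'e \<times> 'e \<Rightarrow> 'e \<times> 'e" where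
  "lin2 a b c d \<equiv> \<lambda>(x, y). (sc a x + sc b y, sc c x + sc d y)"

lemma lin_measurable:
  "(\<lambda>(x, y). sc a x + sc b y) \<in> measurable (borel_norm nm \<Otimes>\<^sub>M borel_norm nm) (borel_norm nm)"
  \<comment> \<open>Only the target is written through its generators, so preimages of open sets
    have to be checked while the source remains a product.\<close>
  unfolding borel_norm_def[of nm, THEN arg_cong[where f = "measurable _"]]
proof (rule measurable_measure_of)
  fix U assume "U \<in> {U. openin (norm_top nm) U}"
  then have U: "\<And>x. x \<in> U \<Longrightarrow> \<exists>r>0. \<forall>y. nm (y - x) < r \<longrightarrow> y \<in> U"
    by (simp add: nm.openin_norm_top)
  have "{(x, y). sc a x + sc b y \<in> U} \<in> sets (borel_norm nm \<Otimes>\<^sub>M borel_norm nm)"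
  proof (rule nm.open_prod_in_sets)
    fix x y assume "(x, y) \<in> {(x, y). sc a x + sc b y \<in> U}"
    then obtain r where r: "r > 0" "\<And>z. nm (z - (sc a x + sc b y)) < r \<Longrightarrow> z \<in> U"
      using U by blast
    \<comment> \<open>The denominator dominates both \<open>av a\<close> and \<open>av b\<close>,
      and the summand 1 keeps it positive when both vanish.\<close>
    define s where "s = r / (av a + av b + 1)"
    have pos: "av a + av b + 1 > 0" using nonneg[of a] nonneg[of b] by linarith
    have "sc a x' + sc b y' \<in> U" if "nm (x' - x) < s" "nm (y' - y) < s" for x' y'
    proof (rule r(2))
      have lt: "av c * t < r" if "av c \<le> av a + av b + 1" "t < s" "0 \<le> t" for c t
      proof -
        have "av c * t \<le> (av a + av b + 1) * t" using that by (intro mult_right_mono)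
        also have "\<dots> < r" using that pos by (simp add: s_def less_divide_eq mult.commute)
        finally show ?thesis .
      qed
      have "nm (sc a x' + sc b y' - (sc a x + sc b y)) = nm (sc a (x' - x) + sc b (y' - y))"
        by (simp add: scale_right_diff_distrib algebra_simps)
      also have "\<dots> \<le> max (av a * nm (x' - x)) (av b * nm (y' - y))"
        using nm.ultra[of "sc a (x' - x)" "sc b (y' - y)"] by simp
      also have "\<dots> < r"
        using lt[of a "nm (x' - x)"] lt[of b "nm (y' - y)"] that nonneg[of a] nonneg[of b] by simp
      finally show "nm (sc a x' + sc b y' - (sc a x + sc b y)) < r" .
    qed
    moreover have "s > 0" using r pos by (simp add: s_def)
    ultimately show "\<exists>r>0. \<forall>x' y'. nm (x' - x) < r \<longrightarrow> nm (y' - y) < r \<longrightarrow>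
        (x', y') \<in> {(x, y). sc a x + sc b y \<in> U}" by blast
  qed
  then show "(\<lambda>(x, y). sc a x + sc b y) -` U \<inter> space (borel_norm nm \<Otimes>\<^sub>M borel_norm nm)
    \<in> sets (borel_norm nm \<Otimes>\<^sub>M borel_norm nm)"
    by (simp add: space_pair_measure vimage_def case_prod_unfold)
qed auto

lemma lin2_measurable:
  "lin2 a b c d \<in> measurable (borel_norm nm \<Otimes>\<^sub>M borel_norm nm) (borel_norm nm \<Otimes>\<^sub>M borel_norm nm)"
  using measurable_Pair[OF lin_measurable[of a b] lin_measurable[of c d]]
  by (simp add: case_prod_unfold)

lemma affine_map_measurable:
  "(\<lambda>x. sc a x + h) \<in> measurable (borel_norm nm) (borel_norm nm)"
proof -
  have "(\<lambda>x. (x, h)) \<in> measurable (borel_norm nm) (borel_norm nm \<Otimes>\<^sub>M borel_norm nm)" by simp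
  from measurable_compose[OF this lin_measurable[of a 1]] show ?thesis by simp
qed

lemmas shift_measurable = affine_map_measurable[of 1, unfolded scale_one]
  and scale_measurable = affine_map_measurable[of _ 0, unfolded add_0_right]

end

text \<open>Instantiated for the law of \<open>X\<close> on \<open>E\<close> and also, with the
  field as a space over itself, for its images under functionals.\<close>

locale nonarch_law = separable_normed_space av sc nm + prob_space \<mu>
  for av :: "'k::field \<Rightarrow> real" and sc :: "'k \<Rightarrow> 'e::ab_group_add \<Rightarrow> 'e" and nm
    and \<mu> :: "'e measure" +
  assumes sets_law: "sets \<mu> = sets (borel_norm nm)"
begin

abbreviation \<B> where "\<B> \<equiv> borel_norm nm"

lemma space_law [simp]: "space \<mu> = UNIV"
  using sets_eq_imp_space_eq[OF sets_law] by simp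

lemma measurable_law: "measurable \<mu> N = measurable \<B> N"
  by (rule measurable_cong_sets[OF sets_law refl])

lemma sets_law2: "sets (\<mu> \<Otimes>\<^sub>M \<mu>) = sets (\<B> \<Otimes>\<^sub>M \<B>)"
  by (intro sets_pair_measure_cong sets_law)

lemma measurable_law2: "measurable (\<mu> \<Otimes>\<^sub>M \<mu>) N = measurable (\<B> \<Otimes>\<^sub>M \<B>) N"
  by (rule measurable_cong_sets[OF sets_law2 refl])

definition invariant2 :: "'k \<Rightarrow> 'k \<Rightarrow> 'k \<Rightarrow> 'k \<Rightarrow> bool" where
  "invariant2 a b c d \<longleftrightarrow> distr (\<mu> \<Otimes>\<^sub>M \<mu>) (\<B> \<Otimes>\<^sub>M \<B>) (lin2 a b c d) = \<mu> \<Otimes>\<^sub>M \<mu>"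

lemma sigma_finite: "sigma_finite_measure \<mu>" ..

lemma emeasure_Times:
  "A \<in> sets \<B> \<Longrightarrow> B \<in> sets \<B> \<Longrightarrow> emeasure (\<mu> \<Otimes>\<^sub>M \<mu>) (A \<times> B) = emeasure \<mu> A * emeasure \<mu> B"
  using sets_law by (intro emeasure_pair_measure_Times) auto

lemma invariant2_Times:
  assumes "invariant2 a b c d" "A \<in> sets \<B>" "B \<in> sets \<B>"
  shows "emeasure (\<mu> \<Otimes>\<^sub>M \<mu>) {(x, y). sc a x + sc b y \<in> A \<and> sc c x + sc d y \<in> B}
    = emeasure \<mu> A * emeasure \<mu> B"
proof -
  have "emeasure \<mu> A * emeasure \<mu> B = emeasure (distr (\<mu> \<Otimes>\<^sub>M \<mu>) (\<B> \<Otimes>\<^sub>M \<B>) (lin2 a b c d)) (A \<times> B)"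
    using assms by (simp add: invariant2_def emeasure_Times)
  also have "\<dots> = emeasure (\<mu> \<Otimes>\<^sub>M \<mu>) (lin2 a b c d -` (A \<times> B) \<inter> space (\<mu> \<Otimes>\<^sub>M \<mu>))"
    using assms by (intro emeasure_distr) (auto simp: measurable_law2 lin2_measurable)
  also have "lin2 a b c d -` (A \<times> B) \<inter> space (\<mu> \<Otimes>\<^sub>M \<mu>)
    = {(x, y). sc a x + sc b y \<in> A \<and> sc c x + sc d y \<in> B}"
    by (auto simp: space_pair_measure)
  finally show ?thesis by simp
qed

text \<open>Invariance passes to matrix products: the parameters are those of the first matrix times
  the second.\<close>

lemma invariant2_compose:
  assumes "invariant2 a b c d" "invariant2 a' b' c' d'"
  shows "invariant2 (a * a' + b * c') (a * b' + b * d') (c * a' + d * c') (c * b' + d * d')"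
proof -
  have "\<mu> \<Otimes>\<^sub>M \<mu> = distr (distr (\<mu> \<Otimes>\<^sub>M \<mu>) (\<B> \<Otimes>\<^sub>M \<B>) (lin2 a' b' c' d')) (\<B> \<Otimes>\<^sub>M \<B>) (lin2 a b c d)"
    using assms by (simp add: invariant2_def)
  also have "\<dots> = distr (\<mu> \<Otimes>\<^sub>M \<mu>) (\<B> \<Otimes>\<^sub>M \<B>) (lin2 a b c d \<circ> lin2 a' b' c' d')"
    by (intro distr_distr) (auto simp: measurable_law2 lin2_measurable)
  also have "lin2 a b c d \<circ> lin2 a' b' c' d'
    = lin2 (a * a' + b * c') (a * b' + b * d') (c * a' + d * c') (c * b' + d * d')"
    by (auto simp: fun_eq_iff scale_right_distrib scale_left_distrib algebra_simps)
  finally show ?thesis by (simp add: invariant2_def)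
qed

lemma invariant2_swap: "invariant2 0 1 1 0"
proof -
  interpret pair_sigma_finite \<mu> \<mu> ..
  have "distr (\<mu> \<Otimes>\<^sub>M \<mu>) (\<B> \<Otimes>\<^sub>M \<B>) (lin2 0 1 1 0) = distr (\<mu> \<Otimes>\<^sub>M \<mu>) (\<mu> \<Otimes>\<^sub>M \<mu>) (\<lambda>(x, y). (y, x))"
    by (intro distr_cong) (auto simp: sets_law2)
  then show ?thesis using distr_pair_swap by (simp add: invariant2_def)
qed

section \<open>Translations, scalings and shears\<close>

definition shift_invariant :: "'e \<Rightarrow> bool" where
  "shift_invariant h \<longleftrightarrow> distr \<mu> \<B> (\<lambda>x. x + h) = \<mu>"

definition scale_invariant :: "'k \<Rightarrow> bool" where
  "scale_invariant u \<longleftrightarrow> distr \<mu> \<B> (sc u) = \<mu>"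

lemma shift_invariant_add:
  assumes "shift_invariant h" "shift_invariant k"
  shows "shift_invariant (h + k)"
proof -
  have "distr \<mu> \<B> (\<lambda>x. x + (h + k)) = distr \<mu> \<B> ((\<lambda>x. x + k) \<circ> (\<lambda>x. x + h))"
    by (simp add: comp_def add.assoc)
  also have "\<dots> = distr (distr \<mu> \<B> (\<lambda>x. x + h)) \<B> (\<lambda>x. x + k)"
    by (intro distr_distr[symmetric]) (auto simp: measurable_law shift_measurable)
  finally show ?thesis using assms by (simp add: shift_invariant_def)
qed

lemma shift_invariant_minus:
  assumes "shift_invariant h"
  shows "shift_invariant (- h)"
proof -
  have "distr \<mu> \<B> (\<lambda>x. x + - h) = distr (distr \<mu> \<B> (\<lambda>x. x + h)) \<B> (\<lambda>x. x + - h)"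
    using assms by (simp add: shift_invariant_def)
  also have "\<dots> = distr \<mu> \<B> ((\<lambda>x. x + - h) \<circ> (\<lambda>x. x + h))"
    by (intro distr_distr) (auto simp: measurable_law shift_measurable simp del: add_uminus_conv_diff)
  also have "\<dots> = \<mu>" by (simp add: comp_def distr_id2 sets_law)
  finally show ?thesis by (simp add: shift_invariant_def)
qed

text \<open>Scaling by \<open>u\<close> conjugates the translation by \<open>h\<close> into the
  translation by \<open>sc u h\<close>.\<close>

lemma shift_invariant_scale:
  assumes h: "shift_invariant h" and u: "scale_invariant u"
  shows "shift_invariant (sc u h)"
proof -
  have "distr \<mu> \<B> (\<lambda>x. x + sc u h) = distr (distr \<mu> \<B> (sc u)) \<B> (\<lambda>x. x + sc u h)"
    using u by (simp add: scale_invariant_def)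
  also have "\<dots> = distr \<mu> \<B> ((\<lambda>x. x + sc u h) \<circ> sc u)"
    by (intro distr_distr) (auto simp: measurable_law shift_measurable scale_measurable)
  also have "\<dots> = distr \<mu> \<B> (sc u \<circ> (\<lambda>x. x + h))"
    by (simp add: comp_def scale_right_distrib)
  also have "\<dots> = distr (distr \<mu> \<B> (\<lambda>x. x + h)) \<B> (sc u)"
    by (intro distr_distr[symmetric]) (auto simp: measurable_law shift_measurable scale_measurable)
  finally show ?thesis using h u by (simp add: shift_invariant_def scale_invariant_def)
qed

text \<open>If \<open>av a < 1\<close> then \<open>1 + a\<close> is a unit and \<open>a h = (1 + a) h - h\<close>.\<close>

lemma shift_invariant_scale_le_1:
  assumes u: "\<And>u. av u = 1 \<Longrightarrow> scale_invariant u" and h: "shift_invariant h" and a: "av a \<le> 1"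
  shows "shift_invariant (sc a h)"
proof (cases "av a = 1")
  case True
  then show ?thesis using shift_invariant_scale u h by blast
next
  case False
  then have "av (1 + a) = 1" using add_less_absorb[of a 1] a by (simp add: add.commute)
  then have "shift_invariant (sc (1 + a) h + - h)"
    by (intro shift_invariant_add shift_invariant_minus shift_invariant_scale u h)
  then show ?thesis by (simp add: scale_left_distrib)
qed

lemma invariant2_diag:
  assumes "scale_invariant u" "scale_invariant v"
  shows "invariant2 u 0 0 v"
proof -
  have "distr \<mu> \<B> (sc u) \<Otimes>\<^sub>M distr \<mu> \<B> (sc v) = distr (\<mu> \<Otimes>\<^sub>M \<mu>) (\<B> \<Otimes>\<^sub>M \<B>) (\<lambda>(x, y). (sc u x, sc v y))"
    using assms sigma_finite
    by (intro pair_measure_distr) (auto simp: measurable_law scale_measurable scale_invariant_def)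
  then show ?thesis using assms by (simp add: invariant2_def scale_invariant_def)
qed

text \<open>For fixed \<open>y\<close> the shear translates \<open>x\<close> by
  \<open>sc a y\<close>; integrating over \<open>y\<close> last is why almost every \<open>y\<close>
  suffices.\<close>

lemma invariant2_shear:
  assumes "AE y in \<mu>. shift_invariant (sc a y)"
  shows "invariant2 1 a 0 1"
  unfolding invariant2_def
proof (rule pair_measure_eqI[symmetric, OF sigma_finite sigma_finite])
  interpret pair_sigma_finite \<mu> \<mu> ..
  show "sets (\<mu> \<Otimes>\<^sub>M \<mu>) = sets (distr (\<mu> \<Otimes>\<^sub>M \<mu>) (\<B> \<Otimes>\<^sub>M \<B>) (lin2 1 a 0 1))"
    by (simp add: sets_law2)
  fix A B assume AB: "A \<in> sets \<mu>" "B \<in> sets \<mu>"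
  then have AB': "A \<times> B \<in> sets (\<B> \<Otimes>\<^sub>M \<B>)" by (simp add: sets_law)
  let ?W = "lin2 1 a 0 1 -` (A \<times> B) \<inter> space (\<mu> \<Otimes>\<^sub>M \<mu>)"
  have m: "lin2 1 a 0 1 \<in> measurable (\<mu> \<Otimes>\<^sub>M \<mu>) (\<B> \<Otimes>\<^sub>M \<B>)"
    by (simp only: measurable_law2 lin2_measurable)
  have "emeasure (distr (\<mu> \<Otimes>\<^sub>M \<mu>) (\<B> \<Otimes>\<^sub>M \<B>) (lin2 1 a 0 1)) (A \<times> B) = emeasure (\<mu> \<Otimes>\<^sub>M \<mu>) ?W"
    by (rule emeasure_distr[OF m AB'])
  also have "\<dots> = (\<integral>\<^sup>+y. emeasure \<mu> ((\<lambda>x. (x, y)) -` ?W) \<partial>\<mu>)"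
    by (rule emeasure_pair_measure_alt2[OF measurable_sets[OF m AB']])
  also have "\<dots> = (\<integral>\<^sup>+y. emeasure \<mu> A * indicator B y \<partial>\<mu>)"
  proof (rule nn_integral_cong_AE, rule AE_mp[OF assms], intro AE_I2 impI)
    fix y assume y: "shift_invariant (sc a y)"
    have "emeasure \<mu> ((\<lambda>x. x + sc a y) -` A \<inter> space \<mu>) = emeasure (distr \<mu> \<B> (\<lambda>x. x + sc a y)) A"
      using AB by (intro emeasure_distr[symmetric]) (auto simp: measurable_law shift_measurable sets_law)
    then have "emeasure \<mu> ((\<lambda>x. x + sc a y) -` A) = emeasure \<mu> A"
      using y by (simp add: shift_invariant_def)
    moreover have "(\<lambda>x. (x, y)) -` ?W = (if y \<in> B then (\<lambda>x. x + sc a y) -` A else {})"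
      by (auto simp: space_pair_measure)
    ultimately show "emeasure \<mu> ((\<lambda>x. (x, y)) -` ?W) = emeasure \<mu> A * indicator B y"
      by simp
  qed
  also have "\<dots> = emeasure \<mu> A * emeasure \<mu> B"
    using AB by (simp add: nn_integral_cmult_indicator)
  finally show "emeasure \<mu> A * emeasure \<mu> B
    = emeasure (distr (\<mu> \<Otimes>\<^sub>M \<mu>) (\<B> \<Otimes>\<^sub>M \<B>) (lin2 1 a 0 1)) (A \<times> B)" by simp
qed

section \<open>Orthonormal pairs as matrices\<close>

lemma orthonormal_K2_iff:
  "orthonormal_K2 av (a, b) (c, d) \<longleftrightarrow> max (av a) (av b) = 1 \<and> max (av c) (av d) = 1 \<and>
     (\<forall>s t. max (av (s * a + t * c)) (av (s * b + t * d)) = max (av s) (av t))"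
  by (auto simp: orthonormal_K2_def Let_def)

text \<open>The combinations with coefficients \<open>(c, - a)\<close> and \<open>(d, - b)\<close>
  each kill one coordinate and leave the determinant, up to sign, in the other. Its value is thus
  the maximum over either column, and some entry of the first row has value 1.\<close>

lemma orthonormal_K2_det:
  assumes "orthonormal_K2 av (a, b) (c, d)"
  shows "av (a * d - b * c) = 1"
proof -
  have o: "max (av a) (av b) = 1" "max (av c) (av d) = 1"
    "\<And>s t. max (av (s * a + t * c)) (av (s * b + t * d)) = max (av s) (av t)"
    using assms unfolding orthonormal_K2_iff by blast+
  have "av (b * c - a * d) = max (av c) (av a)"
    using o(3)[of c "- a"] by (simp add: mult.commute max_absorb2)
  moreover have "av (a * d - b * c) = max (av d) (av b)"
    using o(3)[of d "- b"] by (simp add: mult.commute max_absorb1)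
  ultimately show ?thesis
    using o(1,2) dist_commute[of "a * d" "b * c"] by (auto simp: max_def split: if_splits)
qed

lemma invariant2_orthonormal:
  assumes unit: "\<And>u. av u = 1 \<Longrightarrow> scale_invariant u" and AE: "AE y in \<mu>. shift_invariant y"
    and o: "orthonormal_K2 av (a, b) (c, d)"
  shows "invariant2 a b c d"
proof -
  have shear: "invariant2 1 s 0 1" if "av s \<le> 1" for s
  proof (rule invariant2_shear)
    show "AE y in \<mu>. shift_invariant (sc s y)"
      by (rule AE_mp[OF AE]) (use shift_invariant_scale_le_1[OF unit _ that] in auto)
  qed
  \<comment> \<open>Conjugation by the swap turns an upper shear into a lower one.\<close>
  have lower: "invariant2 1 0 s 1" if "av s \<le> 1" for s
    using invariant2_compose[OF invariant2_swap invariant2_compose[OF shear[OF that] invariant2_swap]]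
    by simp
  \<comment> \<open>Elimination with a unit pivot: lower shear by \<open>c / a\<close>, diagonal
    with entries \<open>a\<close> and determinant over \<open>a\<close>, upper shear by
    \<open>b / a\<close>. The unit pivot keeps both shear parameters in the unit ball and both
    diagonal entries units.\<close>
  have main: "invariant2 a b c d"
    if "av a = 1" "av b \<le> 1" "av c \<le> 1" "av (a * d - b * c) = 1" for a b c d
  proof -
    have a: "a \<noteq> 0" using that(1) by auto
    have "invariant2 a 0 0 ((a * d - b * c) / a)"
      by (intro invariant2_diag unit) (use that in simp_all)
    from invariant2_compose[OF this shear[of "b / a"]]
    have "invariant2 a b 0 ((a * d - b * c) / a)" using that a by simp
    from invariant2_compose[OF lower[of "c / a"] this]
    show ?thesis using that a by (simp add: field_simps)
  qed
  have entries: "max (av a) (av b) = 1" "max (av c) (av d) = 1"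
    using o by (auto simp: orthonormal_K2_iff)
  note det = orthonormal_K2_det[OF o]
  show ?thesis
  proof (cases "av a = 1")
    case True
    then show ?thesis using main[of a b c d] entries det by (simp add: max_def split: if_splits)
  next
    \<comment> \<open>Now \<open>b\<close> is the unit of the first row, and exchanging the columns
      makes it the pivot.\<close>
    case False
    then have "invariant2 b a d c"
      using main[of b a d c] entries det dist_commute[of "a * d" "b * c"]
      by (simp add: max_def mult.commute split: if_splits)
    from invariant2_compose[OF this invariant2_swap] show ?thesis by simp
  qed
qed

section \<open>Image laws under functionals\<close>

lemma law_distr_dual:
  assumes T: "T \<in> dual"
  shows "nonarch_law av (*) av (distr \<mu> (borel_norm av) T)"
proof -
  have "normed_space_K av (*) av"
    unfolding normed_space_K_def
    by (auto simp: ultra vector_space_def algebra_simps)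
  then interpret K: separable_normed_space av "(*)" av
    by unfold_locales (auto intro: separable)
  interpret D: prob_space "distr \<mu> (borel_norm av) T"
    using dual_measurable[OF T] by (intro prob_space_distr) (simp add: measurable_law)
  show ?thesis by unfold_locales simp
qed

lemma emeasure_distr_dual:
  "T \<in> dual \<Longrightarrow> A \<in> sets (borel_norm av) \<Longrightarrow>
     emeasure (distr \<mu> (borel_norm av) T) A = emeasure \<mu> {x. T x \<in> A}"
  by (subst emeasure_distr) (auto simp: measurable_law dual_measurable vimage_def)

text \<open>The passage back to \<open>E\<close>: by \<open>law_eqI\<close>, invariance of the law
  under a map may be checked on each functional separately.\<close>

lemma distr_eq_law:
  assumes f: "f \<in> measurable \<B> \<B>"
    and eq: "\<And>T b. T \<in> dual \<Longrightarrow> emeasure \<mu> {x. av (T (f x) + b) \<le> 1} = emeasure \<mu> {x. av (T x + b) \<le> 1}"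
  shows "distr \<mu> \<B> f = \<mu>"
proof (rule law_eqI)
  have f': "f \<in> measurable \<mu> \<B>" using f by (simp add: measurable_law)
  interpret D: prob_space "distr \<mu> \<B> f" by (rule prob_space_distr[OF f'])
  show "finite_measure (distr \<mu> \<B> f)" "finite_measure \<mu>" by unfold_locales
  fix T b assume T: "T \<in> dual"
  have "measure (distr \<mu> \<B> f) {x. av (T x + b) \<le> 1} = measure \<mu> (f -` {x. av (T x + b) \<le> 1} \<inter> space \<mu>)"
    by (rule measure_distr[OF f' affine_cball_in_sets[OF affineI[OF T]]])
  also have "\<dots> = measure \<mu> {x. av (T x + b) \<le> 1}"
    using eq[OF T, of b] by (simp add: measure_def vimage_def)
  finally show "measure (distr \<mu> \<B> f) {x. av (T x + b) \<le> 1} = measure \<mu> {x. av (T x + b) \<le> 1}" .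
qed (auto simp: sets_law)

text \<open>The map \<open>(x, y) \<mapsto> (T x, T y)\<close> commutes with the matrices and
  carries the product law to the product of the image laws.\<close>

lemma invariant2_distr_dual:
  assumes T: "T \<in> dual" and inv: "invariant2 a b c d"
  shows "nonarch_law.invariant2 (*) av (distr \<mu> (borel_norm av) T) a b c d"
proof -
  let ?K = "borel_norm av" and ?T = "\<lambda>(x, y). (T x, T y)"
  interpret K: nonarch_law av "(*)" av "distr \<mu> ?K T" by (rule law_distr_dual[OF T])
  have Tm: "T \<in> measurable \<mu> ?K" using dual_measurable[OF T] by (simp add: measurable_law)
  have eq: "distr \<mu> ?K T \<Otimes>\<^sub>M distr \<mu> ?K T = distr (\<mu> \<Otimes>\<^sub>M \<mu>) (?K \<Otimes>\<^sub>M ?K) ?T"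
    by (rule pair_measure_distr[OF Tm Tm K.sigma_finite])
  have TTm: "?T \<in> measurable (\<B> \<Otimes>\<^sub>M \<B>) (?K \<Otimes>\<^sub>M ?K)"
    using dual_measurable[OF T] by (simp add: case_prod_unfold)
  have "distr (distr (\<mu> \<Otimes>\<^sub>M \<mu>) (?K \<Otimes>\<^sub>M ?K) ?T) (?K \<Otimes>\<^sub>M ?K) (K.lin2 a b c d)
    = distr (\<mu> \<Otimes>\<^sub>M \<mu>) (?K \<Otimes>\<^sub>M ?K) (K.lin2 a b c d \<circ> ?T)"
    by (rule distr_distr[OF K.lin2_measurable]) (simp only: measurable_law2 TTm)
  also have "K.lin2 a b c d \<circ> ?T = ?T \<circ> lin2 a b c d"
    by (auto simp: fun_eq_iff dual_add[OF T] dual_scale[OF T])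
  also have "distr (\<mu> \<Otimes>\<^sub>M \<mu>) (?K \<Otimes>\<^sub>M ?K) (?T \<circ> lin2 a b c d)
    = distr (distr (\<mu> \<Otimes>\<^sub>M \<mu>) (\<B> \<Otimes>\<^sub>M \<B>) (lin2 a b c d)) (?K \<Otimes>\<^sub>M ?K) ?T"
    by (rule distr_distr[symmetric, OF TTm]) (simp only: measurable_law2 lin2_measurable)
  finally show ?thesis
    using inv by (simp add: K.invariant2_def invariant2_def eq)
qed

section \<open>Laws with Gaussian images\<close>

context
  assumes gauss: "\<And>T a b c d. T \<in> dual \<Longrightarrow> orthonormal_K2 av (a, b) (c, d) \<Longrightarrow>
    nonarch_law.invariant2 (*) av (distr \<mu> (borel_norm av) T) a b c d"
begin

lemma cball_in_sets_field: "{z. av (z + b) \<le> 1} \<in> sets (borel_norm av)"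
  using open_in_sets[OF openin_cball[of 1 "- b"]] by simp

text \<open>The pair \<open>(u, 0)\<close>, \<open>(0, 1)\<close> is orthonormal. Leaving the second
  coordinate unrestricted yields scale invariance of every image law.\<close>

lemma gaussian_scale_invariant:
  assumes u: "av u = 1"
  shows "scale_invariant u"
  unfolding scale_invariant_def
proof (rule distr_eq_law[OF scale_measurable])
  fix T b assume T: "T \<in> dual"
  let ?\<nu> = "distr \<mu> (borel_norm av) T" and ?A = "{z. av (z + b) \<le> 1}"
  interpret K: nonarch_law av "(*)" av ?\<nu> by (rule law_distr_dual[OF T])
  have "orthonormal_K2 av (u, 0) (0, 1)" using u by (simp add: orthonormal_K2_iff)
  then have inv: "K.invariant2 u 0 0 1" by (rule gauss[OF T])
  have uA: "{z. u * z \<in> ?A} \<in> sets (borel_norm av)"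
    using measurable_sets[OF K.scale_measurable cball_in_sets_field] by (simp add: vimage_def)
  have univ: "UNIV \<in> sets (borel_norm av)" using sets.top[of "borel_norm av"] by simp
  have "emeasure ?\<nu> ?A = emeasure ?\<nu> ?A * emeasure ?\<nu> UNIV"
    using K.emeasure_space_1 by simp
  also have "\<dots> = emeasure (?\<nu> \<Otimes>\<^sub>M ?\<nu>) ({z. u * z \<in> ?A} \<times> UNIV)"
  proof -
    have *: "{(x, y). u * x + 0 * y \<in> ?A \<and> 0 * x + 1 * y \<in> UNIV} = {z. u * z \<in> ?A} \<times> UNIV" by auto
    show ?thesis
      using K.invariant2_Times[OF inv cball_in_sets_field univ, of b] unfolding * by (rule sym)
  qed
  also have "\<dots> = emeasure ?\<nu> {z. u * z \<in> ?A}"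
    using K.emeasure_Times[OF uA univ] K.emeasure_space_1 by simp
  finally show "emeasure \<mu> {x. av (T (sc u x) + b) \<le> 1} = emeasure \<mu> {x. av (T x + b) \<le> 1}"
    using emeasure_distr_dual[OF T uA] emeasure_distr_dual[OF T cball_in_sets_field]
    by (simp add: dual_scale[OF T])
qed

text \<open>Restrict \<open>y\<close> to the unit ball about \<open>T h\<close>. A unit ball test on
  \<open>x + y + b\<close> cannot distinguish \<open>y\<close> from \<open>T h\<close> there, so
  shear invariance factors into rectangles, and the mass of that ball cancels. Both balls have
  radius 1, which avoids any limit.\<close>

lemma gaussian_shift_invariant:
  assumes h: "\<And>r. r > 0 \<Longrightarrow> emeasure \<mu> {y. nm (y - h) < r} \<noteq> 0"
  shows "shift_invariant h"
  unfolding shift_invariant_def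
proof (rule distr_eq_law[OF shift_measurable])
  fix T b assume T: "T \<in> dual"
  let ?\<nu> = "distr \<mu> (borel_norm av) T"
  let ?A = "{z. av (z + b) \<le> 1}" and ?A' = "{z. av (z + (T h + b)) \<le> 1}" and ?B = "{z. av (z + - T h) \<le> 1}"
  interpret K: nonarch_law av "(*)" av ?\<nu> by (rule law_distr_dual[OF T])
  have "max (av s) (av (s + t)) = max (av s) (av t)" for s t
    using ultra[of s t] ultra_diff[of "s + t" s] by (auto simp: max_def split: if_splits)
  then have "orthonormal_K2 av (1, 1) (0, 1)" by (simp add: orthonormal_K2_iff)
  then have inv: "K.invariant2 1 1 0 1" by (rule gauss[OF T])
  have "{(x, y). 1 * x + 1 * y \<in> ?A \<and> 0 * x + 1 * y \<in> ?B} = ?A' \<times> ?B"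
  proof -
    have "av (x + y + b) \<le> 1 \<longleftrightarrow> av (x + (T h + b)) \<le> 1" if "av (y + - T h) \<le> 1" for x y
      using add_le_iff[OF that, of "x + (T h + b)"] by (simp add: algebra_simps)
    then show ?thesis by auto
  qed
  then have "emeasure ?\<nu> ?A' * emeasure ?\<nu> ?B = emeasure ?\<nu> ?A * emeasure ?\<nu> ?B"
    using K.invariant2_Times[OF inv cball_in_sets_field cball_in_sets_field, of b "- T h"]
      K.emeasure_Times[OF cball_in_sets_field cball_in_sets_field, of "T h + b" "- T h"] by simp
  \<comment> \<open>By continuity of \<open>T\<close> a small ball about \<open>h\<close> is mapped
    into \<open>?B\<close>, and it is not null by assumption.\<close>
  moreover have "emeasure ?\<nu> ?B \<noteq> 0"
  proof -
    obtain r where r: "r > 0" "\<And>x. nm x < r \<Longrightarrow> av (T x) < 1"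
      using dual_continuous[OF T, of 1] by auto
    have "{y. nm (y - h) < r} \<subseteq> {x. T x \<in> ?B}"
    proof clarify
      fix x assume "nm (x - h) < r"
      from r(2)[OF this] show "av (T x + - T h) \<le> 1" by (simp add: dual_diff[OF T])
    qed
    moreover have "{x. T x \<in> ?B} \<in> sets \<mu>"
      using affine_cball_in_sets[OF affineI[OF T, of "- T h"]] by (simp add: sets_law)
    ultimately have "emeasure \<mu> {y. nm (y - h) < r} \<le> emeasure \<mu> {x. T x \<in> ?B}"
      by (rule emeasure_mono)
    then show ?thesis
      unfolding emeasure_distr_dual[OF T cball_in_sets_field] using h[OF r(1)] by (metis le_zero_eq)
  qed
  ultimately have "emeasure ?\<nu> ?A' = emeasure ?\<nu> ?A"
    using K.emeasure_finite by (metis ennreal_mult_cancel_left mult.commute infinity_ennreal_def)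
  then show "emeasure \<mu> {x. av (T (x + h) + b) \<le> 1} = emeasure \<mu> {x. av (T x + b) \<le> 1}"
    by (simp add: emeasure_distr_dual[OF T cball_in_sets_field] dual_add[OF T] add.assoc)
qed

lemma gaussian_invariant2:
  assumes "orthonormal_K2 av (a, b) (c, d)"
  shows "invariant2 a b c d"
proof (rule invariant2_orthonormal[OF gaussian_scale_invariant _ assms])
  show "AE y in \<mu>. shift_invariant y"
    using nm.AE_support[OF sets_law] by (rule AE_mp) (auto intro: gaussian_shift_invariant)
qed

end

end

theorem theorem4p4:
  fixes av :: "'k::field \<Rightarrow> real"
    and sc :: "'k \<Rightarrow> 'e::ab_group_add \<Rightarrow> 'e"
    and nm :: "'e \<Rightarrow> real"
    and M :: "'a measure"
    and X :: "'a \<Rightarrow> 'e"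
  assumes "local_field av"
    and "separable_banach_K av sc nm"
    and "prob_space M"
    and "X \<in> measurable M (borel_norm nm)"
  shows "K_gaussian av sc nm M X \<longleftrightarrow>
         (\<forall>T \<in> dual_space_K av sc nm. K_gaussian av (*) av M (T \<circ> X))"
proof -
  interpret nonarch_law av sc nm "distr M (borel_norm nm) X"
    using assms prob_space.prob_space_distr[OF assms(3,4)]
    by (simp add: nonarch_law_def nonarch_law_axioms_def separable_normed_space_def
        separable_normed_space_axioms_def nonarch_local_field_def nonarch_local_field_axioms_def
        valued_field_def local_field_def separable_banach_K_def)
  let ?\<mu> = "distr M (borel_norm nm) X" and ?K = "borel_norm av"
  have E: "K_gaussian av sc nm M X \<longleftrightarrow>
    (\<forall>a b c d. orthonormal_K2 av (a, b) (c, d) \<longrightarrow> invariant2 a b c d)"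
    by (simp add: K_gaussian_def invariant2_def Let_def)
  have K: "K_gaussian av (*) av M (T \<circ> X) \<longleftrightarrow> (\<forall>a b c d. orthonormal_K2 av (a, b) (c, d) \<longrightarrow>
      nonarch_law.invariant2 (*) av (distr ?\<mu> ?K T) a b c d)" if T: "T \<in> dual" for T
  proof -
    \<comment> \<open>Gaussianity of \<open>T \<circ> X\<close> thereby becomes a property of the
      image of the law of \<open>X\<close>.\<close>
    have "distr M ?K (T \<circ> X) = distr ?\<mu> ?K T"
      using distr_distr[OF dual_measurable[OF T] assms(4)] by simp
    then show ?thesis
      by (simp add: K_gaussian_def Let_def nonarch_law.invariant2_def[OF law_distr_dual[OF T]])
  qed
  show ?thesis
    unfolding E
  proof
    assume "\<forall>a b c d. orthonormal_K2 av (a, b) (c, d) \<longrightarrow> invariant2 a b c d"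
    then show "\<forall>T\<in>dual. K_gaussian av (*) av M (T \<circ> X)"
      using K invariant2_distr_dual by simp
  next
    assume "\<forall>T\<in>dual. K_gaussian av (*) av M (T \<circ> X)"
    then have "nonarch_law.invariant2 (*) av (distr ?\<mu> ?K T) a b c d"
      if "T \<in> dual" "orthonormal_K2 av (a, b) (c, d)" for T a b c d
      using K that by simp
    from gaussian_invariant2[OF this]
    show "\<forall>a b c d. orthonormal_K2 av (a, b) (c, d) \<longrightarrow> invariant2 a b c d" by simp
  qed
qed

end
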